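(* Assume $\beta_q\in L_1(\mathbb R_+)$ for $q=1,2$ (together with the standing assumptions in the context), and let $c>0$, $k>0$. Let $(U^n)_{n\ge0}$ be defined by the Crank–Nicolson interpolation-quadrature scheme $$\delta_tU^n+\sum_{q=1}^2Q^{(q)}_{n-1/2}(\mathbf B_qU)=f^{n-\frac12},\quad n\ge1,\qquad U^0=u_0 .$$ Then $$\|U^n\|_A^2\le\frac{e^{c}(1+e^{\frac c2})^4}{(e^{\frac c2}-1)^6}\Big(k\|f^0\|+2\|U^0\|\Big)^2+\sum_{q=1}^2\frac{\|\beta_q\|^2_{L_1(0,\infty)}(1+e^{\frac c2})^4k^2}{e^{c}(e^{\frac c2}-1)^2}\|\mathbf B_qU^0\|^2+\frac{(1+e^{\frac c2})^4k^2}{2(e^{c}-1)^2}\left(\sum_{n=0}^\infty e^{-\frac c2n}\|f^n\|\right)^2,$$ where $\|U^n\|_A=\sqrt{\sum_{n=0}^\infty e^{-cn}\|U^n\|^2}$.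
   Context: $H$ is a real Hilbert space (such as $L^2(\Omega)$) with norm $\|\cdot\|$. The scheme discretizes the problem $u'(t)+\sum_{q=1}^2\int_0^t\beta_q(t-s)\mathbf B_qu(s)\,ds=f(t)$, $t>0$, $u(0)=u_0$, with $f:[0,\infty)\to H$. Standing assumptions: each $\mathbf B_q$ is a positive self-adjoint linear operator on a dense subspace $\mathcal D(\mathbf B_q)\subset H$; each $\beta_q$ is real-valued and of positive type on $(0,\infty)$ (i.e. $\int_0^T\varphi(t)\int_0^t\beta_q(t-s)\varphi(s)\,ds\,dt\ge0$ for all $T>0$ and continuous real $\varphi$), with $\int_0^1\beta_q\,dt<\infty$ and $0\le\beta_q(\infty)<\beta_q(0^+)\le\infty$. All $U^n$ lie in $\mathcal D(\mathbf B_1)\cap\mathcal D(\mathbf B_2)$. Notation: $k>0$ is the time step, $t_n=nk$, $f^n=f(t_n)$, $\delta_tv^n=(v^n-v^{n-1})/k$, $v^{n-\frac12}=\frac12(v^n+v^{n-1})$. Interpolation quadrature: with $h(t)=\max(1-|t|,0)$, $$\chi^{(q)}_{0,0}=0,\qquad \chi^{(q)}_{n,0}=\int_0^k\beta_q(t_n-\zeta)h(\zeta/k)\,d\zeta\ (n\ge1),\qquad w^{(q)}_n=\int_{-k}^{\min(k,t_n)}\beta_q(t_n-\zeta)h(\zeta/k)\,d\zeta\ (n\ge0),$$ $$Q^{(q)}_n(\varphi)=\chi^{(q)}_{n,0}\varphi^0+\sum_{l=1}^nw^{(q)}_{n-l}\varphi^l,\qquad Q^{(q)}_{n-\frac12}(\varphi)=\tfrac12\big(Q^{(q)}_n(\varphi)+Q^{(q)}_{n-1}(\varphi)\big)\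 (n\ge1).$$ *)

theory Defs
  imports "HOL-Analysis.Analysis"
begin

text \<open>
  An unbounded operator is a total function \<open>B\<close> together with its domain \<open>D\<close>; values of \<open>B\<close>
  outside \<open>D\<close> are irrelevant. The last clause of \<open>self_adjoint\<close> says \<open>B\<^sup>* = B\<close> as graphs, so
  it includes equality of the domains, not just symmetry.
\<close>

definition linear_operator_on :: "'a::real_vector set \<Rightarrow> ('a \<Rightarrow> 'a) \<Rightarrow> bool" where
  "linear_operator_on D B \<longleftrightarrow>
     subspace D \<and>
     (\<forall>x\<in>D. \<forall>y\<in>D. B (x + y) = B x + B y) \<and>
     (\<forall>r. \<forall>x\<in>D. B (r *\<^sub>R x) = r *\<^sub>R B x)"

definition adjoint_graph :: "'a::real_inner set \<Rightarrow> ('a \<Rightarrow> 'a) \<Rightarrow> ('a \<times> 'a) set" where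
  "adjoint_graph D B = {(y, z). \<forall>x\<in>D. inner (B x) y = inner x z}"

definition self_adjoint :: "'a::real_inner set \<Rightarrow> ('a \<Rightarrow> 'a) \<Rightarrow> bool" where
  "self_adjoint D B \<longleftrightarrow>
     linear_operator_on D B \<and> closure D = UNIV \<and>
     adjoint_graph D B = {(y, B y) | y. y \<in> D}"

definition positive_self_adjoint :: "'a::real_inner set \<Rightarrow> ('a \<Rightarrow> 'a) \<Rightarrow> bool" where
  "positive_self_adjoint D B \<longleftrightarrow> self_adjoint D B \<and> (\<forall>x\<in>D. 0 \<le> inner (B x) x)"

text \<open>
  Kernels are functions on the open half-line: the value at \<open>0\<close> (or below) never matters, since
  every integral below evaluates them at positive arguments up to a null set.
\<close>

definition positive_type :: "(real \<Rightarrow> real) \<Rightarrow> bool" where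
  "positive_type \<beta> \<longleftrightarrow>
     (\<forall>T>0. \<forall>\<phi>::real \<Rightarrow> real. continuous_on {0..T} \<phi> \<longrightarrow>
        0 \<le> (LINT t:{0..T}|lebesgue. \<phi> t * (LINT s:{0..t}|lebesgue. \<beta> (t - s) * \<phi> s)))"

text \<open>The limit at \<open>0\<close> from the right is taken in the extended reals, so that it may be \<open>\<infinity>\<close>.\<close>

definition admissible_kernel :: "(real \<Rightarrow> real) \<Rightarrow> bool" where
  "admissible_kernel \<beta> \<longleftrightarrow>
     positive_type \<beta> \<and>
     set_integrable lebesgue {0<..<1} \<beta> \<and>
     (\<exists>(b_inf::real) (b_zero::ereal).
        (\<beta> \<longlongrightarrow> b_inf) at_top \<and>
        ((\<lambda>t. ereal (\<beta> t)) \<longlongrightarrow> b_zero) (at_right 0) \<and>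
        0 \<le> b_inf \<and> ereal b_inf < b_zero)"

definition L1_norm :: "(real \<Rightarrow> real) \<Rightarrow> real" where
  "L1_norm \<beta> = (LINT t:{0<..}|lebesgue. \<bar>\<beta> t\<bar>)"

definition hat :: "real \<Rightarrow> real" where
  "hat t = max (1 - \<bar>t\<bar>) 0"

definition quad_chi :: "real \<Rightarrow> (real \<Rightarrow> real) \<Rightarrow> nat \<Rightarrow> real" where
  "quad_chi k \<beta> n =
     (if n = 0 then 0 else (LINT \<zeta>:{0..k}|lebesgue. \<beta> (real n * k - \<zeta>) * hat (\<zeta> / k)))"

definition quad_w :: "real \<Rightarrow> (real \<Rightarrow> real) \<Rightarrow> nat \<Rightarrow> real" where
  "quad_w k \<beta> n =
     (LINT \<zeta>:{-k..min k (real n * k)}|lebesgue. \<beta> (real n * k - \<zeta>) * hat (\<zeta> / k))"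

definition quad :: "real \<Rightarrow> (real \<Rightarrow> real) \<Rightarrow> (nat \<Rightarrow> 'a::real_vector) \<Rightarrow> nat \<Rightarrow> 'a" where
  "quad k \<beta> \<phi> n = quad_chi k \<beta> n *\<^sub>R \<phi> 0 + (\<Sum>l=1..n. quad_w k \<beta> (n - l) *\<^sub>R \<phi> l)"

text \<open>
  \<open>half_level v n\<close> is \<open>v\<close> at level \<open>n - 1/2\<close>; like \<open>backward_diff\<close> it is meant for \<open>n \<ge> 1\<close> only.
\<close>

definition backward_diff :: "real \<Rightarrow> (nat \<Rightarrow> 'a::real_vector) \<Rightarrow> nat \<Rightarrow> 'a" where
  "backward_diff k v n = (v n - v (n - 1)) /\<^sub>R k"

definition half_level :: "(nat \<Rightarrow> 'a::real_vector) \<Rightarrow> nat \<Rightarrow> 'a" where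
  "half_level v n = midpoint (v n) (v (n - 1))"

definition grid :: "real \<Rightarrow> (real \<Rightarrow> 'a) \<Rightarrow> nat \<Rightarrow> 'a" where
  "grid k f n = f (real n * k)"

text \<open>The weighted norm takes the value \<open>\<infinity>\<close> when the defining series diverges.\<close>

definition norm_A :: "real \<Rightarrow> (nat \<Rightarrow> 'a::real_normed_vector) \<Rightarrow> ennreal" where
  "norm_A c U =
     (if summable (\<lambda>n. exp (- c * real n) * (norm (U n))\<^sup>2)
      then ennreal (sqrt (\<Sum>n. exp (- c * real n) * (norm (U n))\<^sup>2))
      else \<infinity>)"

end

theory Submission
  imports Defs
begin

text \<open>
  With \<open>a = e\<^sup>c\<^sup>/\<^sup>2\<close>, \<open>r = 1/a\<close>, put \<open>V\<^sup>0 = 0\<close>, \<open>V\<^sup>n = U\<^sup>n\<close> for \<open>n \<ge> 1\<close>, and let \<open>W\<close> solve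
  \<open>W\<^sup>n + W\<^sup>n\<^sup>-\<^sup>1 = V\<^sup>n\<close>, \<open>W\<^sup>0 = 0\<close>. This undoes the averaging in the scheme, which becomes
  \<open>(2/k)(W\<^sup>n - W\<^sup>n\<^sup>-\<^sup>1) + \<Sum>\<^sub>q Q\<^sub>n(B\<^sub>q U) = f\<^sup>n + (-1)\<^sup>n\<^sup>-\<^sup>1 (f\<^sup>0 + (2/k) U\<^sup>0)\<close>. Testing with \<open>r\<^sup>2\<^sup>n V\<^sup>n\<close>, the difference term
  contributes at least \<open>(2/k) (1-r)/(1+r) \<parallel>V\<parallel>\<^sub>A\<^sup>2\<close>. The memory terms \<open>\<Sum>\<^sub>n r\<^sup>2\<^sup>n \<langle>\<Sum>\<^sub>l w\<^sub>n\<^sub>-\<^sub>l B\<^sub>q V\<^sup>l, V\<^sup>n\<rangle>\<close> are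
  nonnegative: the hat function is an autocorrelation of a box, so \<open>\<Sum> w\<^sub>n\<^sub>-\<^sub>l a\<^sub>n a\<^sub>l\<close> is the
  positive-type form of \<open>\<beta>\<^sub>q\<close> at a step function; vector values are handled by the Schur product
  theorem and the decreasing weight by Abel summation. What remains on the right-hand side is bounded
  in the weighted \<open>\<ell>\<^sup>1\<close> norm, using \<open>\<Sum>\<^sub>n\<^sub>\<ge>\<^sub>1 |\<chi>\<^sub>n\<^sub>,\<^sub>0| \<le> \<parallel>\<beta>\<^sub>q\<parallel>\<^sub>1\<close>.
\<close>

subsection \<open>Quadrature weights of an integrable kernel\<close>

lemma hat_measurable [measurable]: "hat \<in> borel_measurable borel"
  unfolding hat_def by measurable

text \<open>Working form of a kernel: \<open>\<kappa>\<close> lives on the whole line and is Borel,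
  as the Fubini argument below requires. Its vanishing on \<open>u \<le> 0\<close> turns the cut-off
  integrals of the scheme into convolutions over the line.\<close>

locale causal_kernel =
  fixes \<kappa> :: "real \<Rightarrow> real"
  assumes integrable_kernel: "integrable lborel \<kappa>"
    and causal: "u \<le> 0 \<Longrightarrow> \<kappa> u = 0"
begin

lemma kernel_measurable [measurable]: "\<kappa> \<in> borel_measurable borel"
  using borel_measurable_integrable[OF integrable_kernel] by simp

lemma integrable_kernel_affine: "integrable lborel (\<lambda>s. \<kappa> (t - s))"
  using lborel_integrable_real_affine[OF integrable_kernel, of "-1" t] by simp

lemma integrable_kernel_conv:
  assumes [measurable]: "g \<in> borel_measurable borel" and "\<And>s. \<bar>g s\<bar> \<le> C"
  shows "integrable lborel (\<lambda>s. \<kappa> (t - s) * g s)"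
  by (rule Bochner_Integration.integrable_bound[where f="\<lambda>s. C * \<kappa> (t - s)"])
     (use assms(2) in \<open>auto intro!: integrable_kernel_affine simp: abs_mult mult.commute[of C]
        intro!: mult_mono' order.trans[OF assms(2) abs_ge_self]\<close>)

lemma integrable_kernel_times:
  assumes [measurable]: "g \<in> borel_measurable borel" and "\<And>s. \<bar>g s\<bar> \<le> C"
  shows "integrable lborel (\<lambda>s. \<kappa> s * g s)"
  by (rule Bochner_Integration.integrable_bound[where f="\<lambda>s. C * \<kappa> s"])
     (use assms(2) in \<open>auto intro!: integrable_kernel simp: abs_mult mult.commute[of C]
        intro!: mult_mono' order.trans[OF assms(2) abs_ge_self]\<close>)

text \<open>The index is an integer, so that \<open>weight k (int i - int j)\<close> is a full
  Toeplitz matrix; its entries with \<open>i \<ge> j\<close> are the quadrature weights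
  (\<open>quad_w_eq\<close>).\<close>

definition weight :: "real \<Rightarrow> int \<Rightarrow> real" where
  "weight k m = (LINT u|lborel. \<kappa> u * hat (of_int m - u / k))"

text \<open>For \<open>u > 0\<close> the argument \<open>m - u / k\<close> lies below -1, outside
  the support of the hat. Hence the Toeplitz matrix is lower triangular.\<close>

lemma weight_negative:
  assumes "k > 0" "m < 0"
  shows "weight k m = 0"
proof -
  have "\<kappa> u * hat (of_int m - u / k) = 0" for u
  proof (cases "u \<le> 0")
    case False
    then have "u / k > 0" using assms by simp
    moreover have "of_int m \<le> (-1::real)" using assms by linarith
    ultimately show ?thesis by (simp add: hat_def)
  qed (simp add: causal)
  then show ?thesis unfolding weight_def by (simp only: Bochner_Integration.integral_zero)
qed

end

text \<open>\<open>\<beta>\<close> is only Lebesgue measurable, so it is traded for a Borel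
  \<open>\<kappa>\<close>. Equality is recorded off a fixed null set \<open>N\<close>, whose
  preimage under \<open>s \<mapsto> t - s\<close> is again null for every \<open>t\<close>.\<close>

locale kernel_representative = causal_kernel \<kappa> for \<kappa> +
  fixes \<beta> :: "real \<Rightarrow> real" and N :: "real set"
  assumes null: "N \<in> null_sets lborel"
    and kernel_eq: "u \<notin> N \<Longrightarrow> 0 < u \<Longrightarrow> \<kappa> u = \<beta> u"

lemma kernel_representative_exists:
  assumes "set_integrable lebesgue {0<..} \<beta>"
  obtains \<kappa> N where "kernel_representative \<kappa> \<beta> N"
proof -
  define b where "b = (\<lambda>u::real. indicator {0<..} u * \<beta> u)"
  have b: "integrable lebesgue b"
    using assms by (simp add: set_integrable_def b_def)
  obtain g where g [measurable]: "g \<in> borel_measurable borel" and ae: "AE x in lborel. b x = g x"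
    using completion_ex_borel_measurable_real[OF borel_measurable_integrable[OF b]] by auto
  have gi: "integrable lborel g"
  proof -
    have "integrable lebesgue g"
      by (rule integrable_cong_AE_imp[OF b]) (use ae in \<open>auto intro: measurable_completion simp: AE_completion_iff\<close>)
    then show ?thesis by (simp add: integrable_completion)
  qed
  obtain N where N: "{x. b x \<noteq> g x} \<subseteq> N" "N \<in> null_sets lborel"
    using ae by (auto simp: eventually_ae_filter)
  show thesis
  proof
    \<comment> \<open>The indicator is put back because \<open>g\<close> is known to vanish on the
      negative half-line only almost everywhere, whereas \<open>causal\<close> is a pointwise
      condition.\<close>
    show "kernel_representative (\<lambda>u. indicator {0<..} u * g u) \<beta> N"
    proof
      show "integrable lborel (\<lambda>u. indicator {0<..} u * g u)"
        using integrable_real_mult_indicator[OF _ gi] by (simp add: mult.commute)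
      show "indicator {0<..} u * g u = \<beta> u" if "u \<notin> N" "0 < u" for u
      proof -
        have "b u = g u" using that N by blast
        then show ?thesis using that by (simp add: b_def)
      qed
    qed (use N in auto)
  qed
qed

context kernel_representative
begin

text \<open>Reflections preserve null sets, so \<open>t - s\<close> avoids \<open>N\<close> for
  almost all \<open>s\<close>. On \<open>A\<close> the argument \<open>t - s\<close> is positive
  except at the single point \<open>s = t\<close>, hence \<open>\<kappa>\<close> and
  \<open>\<beta>\<close> agree there almost everywhere.\<close>

lemma set_integral_convolution:
  assumes A [measurable]: "A \<in> sets borel" and sub: "A \<subseteq> {..t}"
    and g [measurable]: "g \<in> borel_measurable borel"
  shows "(LINT s:A|lebesgue. \<beta> (t - s) * g s) = (LINT s|lborel. \<kappa> (t - s) * (g s * indicator A s))"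
proof -
  have [measurable]: "N \<in> sets borel" using null by auto
  have "AE s in lborel. s \<notin> N" using null by (rule AE_not_in)
  then have "AE s in lborel. t + (-1) * s \<notin> N"
    by (rule AE_borel_affine[where P="\<lambda>s. s \<notin> N", rotated -1]) auto
  moreover have "AE s in lborel. s \<noteq> t" by (rule AE_lborel_singleton)
  ultimately have "AE s in lborel. \<kappa> (t - s) * (g s * indicator A s) = indicator A s *\<^sub>R (\<beta> (t - s) * g s)"
  proof eventually_elim
    case (elim s)
    show ?case
    proof (cases "s \<in> A")
      case True
      then have "s \<le> t" using sub by auto
      then show ?thesis using True elim kernel_eq[of "t - s"] by simp
    qed simp
  qed
  then have ae: "AE s in lebesgue. \<kappa> (t - s) * (g s * indicator A s) = indicator A s *\<^sub>R (\<beta> (t - s) * g s)"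
    by (simp add: AE_completion_iff)
  have m: "(\<lambda>s. \<kappa> (t - s) * (g s * indicator A s)) \<in> borel_measurable lborel" by simp
  then have m': "(\<lambda>s. \<kappa> (t - s) * (g s * indicator A s)) \<in> borel_measurable lebesgue"
    by (rule measurable_completion)
  have "(LINT s:A|lebesgue. \<beta> (t - s) * g s) = (LINT s|lebesgue. \<kappa> (t - s) * (g s * indicator A s))"
    unfolding set_lebesgue_integral_def
    by (rule integral_cong_AE[symmetric]) (use ae m' borel_measurable_AE[OF m' ae] in auto)
  also have "\<dots> = (LINT s|lborel. \<kappa> (t - s) * (g s * indicator A s))"
    by (rule integral_completion[OF m])
  finally show ?thesis .
qed

text \<open>Outside the limits of integration a factor vanishes: the hat off \<open>{-k..k}\<close>,
  the kernel beyond \<open>n * k\<close>. So the integral extends to the line, and the reflection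
  \<open>u = n * k - s\<close> gives \<open>weight\<close>.\<close>

lemma quad_w_eq:
  assumes k: "k > 0"
  shows "quad_w k \<beta> n = weight k (int n)"
proof -
  have "quad_w k \<beta> n = (LINT s|lborel. \<kappa> (real n * k - s) * (hat (s / k) * indicator {-k..min k (real n * k)} s))"
    unfolding quad_w_def by (rule set_integral_convolution) auto
  also have "\<dots> = (LINT s|lborel. \<kappa> (real n * k - s) * hat (s / k))"
  proof (rule Bochner_Integration.integral_cong[OF refl])
    fix s
    show "\<kappa> (real n * k - s) * (hat (s / k) * indicator {-k..min k (real n * k)} s) = \<kappa> (real n * k - s) * hat (s / k)"
    proof (cases "s \<in> {-k..min k (real n * k)}")
      case False
      then consider "s < -k" | "s > k" | "s > real n * k" by fastforce
      then show ?thesis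
      proof cases
        case 1 then have "s / k < -1" using k by (simp add: field_simps)
        then show ?thesis by (simp add: hat_def del: abs_divide)
      next
        case 2 then have "s / k > 1" using k by (simp add: field_simps)
        then show ?thesis by (simp add: hat_def del: abs_divide)
      next
        case 3 then show ?thesis by (simp add: causal)
      qed
    qed simp
  qed
  also have "\<dots> = (LINT s|lborel. \<kappa> s * hat ((real n * k - s) / k))"
    using lborel_integral_real_affine[of "-1" "\<lambda>s. \<kappa> s * hat ((real n * k - s) / k)" "real n * k"]
    by simp
  also have "\<dots> = weight k (int n)"
    unfolding weight_def using k by (intro Bochner_Integration.integral_cong) (auto simp: diff_divide_distrib)
  finally show ?thesis .
qed

lemma L1_norm_eq: "L1_norm \<beta> = (LINT u|lborel. \<bar>\<kappa> u\<bar>)"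
proof -
  have "AE u in lborel. u \<notin> N" using null by (rule AE_not_in)
  then have "AE u in lborel. \<bar>\<kappa> u\<bar> = indicator {0<..} u *\<^sub>R \<bar>\<beta> u\<bar>"
  proof eventually_elim
    case (elim u)
    then show ?case by (cases "u > 0") (auto simp: causal kernel_eq)
  qed
  then have ae: "AE u in lebesgue. \<bar>\<kappa> u\<bar> = indicator {0<..} u *\<^sub>R \<bar>\<beta> u\<bar>"
    by (simp add: AE_completion_iff)
  have m: "(\<lambda>u. \<bar>\<kappa> u\<bar>) \<in> borel_measurable lborel" by simp
  then have m': "(\<lambda>u. \<bar>\<kappa> u\<bar>) \<in> borel_measurable lebesgue"
    by (rule measurable_completion)
  have "L1_norm \<beta> = (LINT u|lebesgue. \<bar>\<kappa> u\<bar>)"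
    unfolding set_lebesgue_integral_def L1_norm_def
    by (rule integral_cong_AE[symmetric]) (use ae m' borel_measurable_AE[OF m' ae] in auto)
  also have "\<dots> = (LINT u|lborel. \<bar>\<kappa> u\<bar>)"
    by (rule integral_completion[OF m])
  finally show ?thesis .
qed

text \<open>After the same reflection the n-th coefficient integrates \<open>\<kappa>\<close>
  against a half-hat on \<open>{n * k - k..n * k}\<close>. These half-hats have values at most 1 and
  intervals that meet only in endpoints, so they add up to at most 1.\<close>

lemma sum_quad_chi_le:
  assumes k: "k > 0"
  shows "(\<Sum>n=1..M. \<bar>quad_chi k \<beta> n\<bar>) \<le> L1_norm \<beta>"
proof -
  define h where "h n u = hat (real n - u / k) * indicator {real n * k - k..real n * k} u" for n u
  have [measurable]: "h n \<in> borel_measurable borel" for n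
    unfolding h_def by measurable
  have h_bound: "0 \<le> h n u" "h n u \<le> 1" for n u
    unfolding h_def by (auto simp: hat_def indicator_def)
  have int: "integrable lborel (\<lambda>u. \<bar>\<kappa> u\<bar> * h n u)" for n
  proof -
    have "integrable lborel (\<lambda>u. \<bar>\<kappa> u * h n u\<bar>)"
      by (intro integrable_abs integrable_kernel_times[where C=1]) (use h_bound in auto)
    then show ?thesis by (simp add: abs_mult h_bound)
  qed
  have chi: "\<bar>quad_chi k \<beta> n\<bar> \<le> (LINT u|lborel. \<bar>\<kappa> u\<bar> * h n u)" if "n \<ge> 1" for n
  proof -
    have "{0..k} \<subseteq> {..real n * k}"
      using that k by (auto intro: order.trans[of _ k])
    then have "quad_chi k \<beta> n = (LINT s|lborel. \<kappa> (real n * k - s) * (hat (s / k) * indicator {0..k} s))"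
      unfolding quad_chi_def using that by (simp add: set_integral_convolution)
    also have "\<dots> = (LINT s|lborel. \<kappa> s * (hat ((real n * k - s) / k) * indicator {0..k} (real n * k - s)))"
      using lborel_integral_real_affine[of "-1" "\<lambda>s. \<kappa> s * (hat ((real n * k - s) / k) * indicator {0..k} (real n * k - s))" "real n * k"]
      by simp
    also have "\<dots> = (LINT u|lborel. \<kappa> u * h n u)"
      unfolding h_def using k by (intro Bochner_Integration.integral_cong) (auto simp: diff_divide_distrib indicator_def)
    finally have "\<bar>quad_chi k \<beta> n\<bar> = \<bar>LINT u|lborel. \<kappa> u * h n u\<bar>" by simp
    also have "\<dots> \<le> (LINT u|lborel. \<bar>\<kappa> u * h n u\<bar>)" by (rule integral_abs_bound)
    finally show ?thesis by (simp add: abs_mult h_bound)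
  qed
  have h_sum: "(\<Sum>n=1..M. h n u) \<le> 1" for u
  proof -
    \<comment> \<open>At a common endpoint \<open>u = (n - 1) * k\<close> the half-hat with index
      \<open>n\<close> is zero, so only the index given by the ceiling of \<open>u / k\<close> can
      contribute.\<close>
    have "h n u \<le> (if n = nat \<lceil>u / k\<rceil> then 1 else 0)" if "n \<ge> 1" for n
    proof (cases "real n - 1 < u / k \<and> u / k \<le> real n")
      case True
      then have "\<lceil>u / k\<rceil> = int n" by (intro ceiling_unique) auto
      then show ?thesis using h_bound by simp
    next
      case False
      then have "h n u = 0" using k by (auto simp: h_def hat_def indicator_def field_simps)
      then show ?thesis by simp
    qed
    then have "(\<Sum>n=1..M. h n u) \<le> (\<Sum>n=1..M. if n = nat \<lceil>u / k\<rceil> then 1 else 0)"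
      by (intro sum_mono) auto
    also have "\<dots> \<le> 1" by simp
    finally show ?thesis .
  qed
  have "(\<Sum>n=1..M. \<bar>quad_chi k \<beta> n\<bar>) \<le> (\<Sum>n=1..M. LINT u|lborel. \<bar>\<kappa> u\<bar> * h n u)"
    by (intro sum_mono chi) auto
  also have "\<dots> = (LINT u|lborel. (\<Sum>n=1..M. \<bar>\<kappa> u\<bar> * h n u))"
    by (rule Bochner_Integration.integral_sum[symmetric]) (rule int)
  also have "\<dots> \<le> (LINT u|lborel. \<bar>\<kappa> u\<bar>)"
  proof (rule integral_mono)
    show "(\<Sum>n=1..M. \<bar>\<kappa> u\<bar> * h n u) \<le> \<bar>\<kappa> u\<bar>" for u
      using mult_left_mono[OF h_sum[of u], of "\<bar>\<kappa> u\<bar>"] by (simp add: sum_distrib_left)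
  qed (auto intro: int integrable_kernel)
  finally show ?thesis by (simp add: L1_norm_eq)
qed

end

subsection \<open>Positivity of the quadrature form\<close>

context causal_kernel
begin

text \<open>The form of \<open>positive_type\<close> on the whole line, made bilinear so that it can
  be expanded on sums of boxes.\<close>

definition energy :: "(real \<Rightarrow> real) \<Rightarrow> (real \<Rightarrow> real) \<Rightarrow> real" where
  "energy \<phi> \<psi> = (LINT t|lborel. \<phi> t * (LINT s|lborel. \<kappa> (t - s) * \<psi> s))"

lemma convolution_measurable [measurable]:
  assumes [measurable]: "\<psi> \<in> borel_measurable borel"
  shows "(\<lambda>t. LINT s|lborel. \<kappa> (t - s) * \<psi> s) \<in> borel_measurable borel"
proof -
  have "(\<lambda>(t, s). \<kappa> (t - s) * \<psi> s) \<in> borel_measurable (borel \<Otimes>\<^sub>M lborel)"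
    by measurable
  then show ?thesis
    using lborel.borel_measurable_lebesgue_integral by fastforce
qed

lemma convolution_bound:
  assumes [measurable]: "\<psi> \<in> borel_measurable borel" and bd: "\<And>s. \<bar>\<psi> s\<bar> \<le> C"
  shows "\<bar>LINT s|lborel. \<kappa> (t - s) * \<psi> s\<bar> \<le> C * (LINT u|lborel. \<bar>\<kappa> u\<bar>)"
proof -
  have "\<bar>LINT s|lborel. \<kappa> (t - s) * \<psi> s\<bar> \<le> (LINT s|lborel. \<bar>\<kappa> (t - s) * \<psi> s\<bar>)"
    by (rule integral_abs_bound)
  also have "\<dots> \<le> (LINT s|lborel. C * \<bar>\<kappa> (t - s)\<bar>)"
  proof (rule integral_mono)
    show "\<bar>\<kappa> (t - s) * \<psi> s\<bar> \<le> C * \<bar>\<kappa> (t - s)\<bar>" for s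
      using mult_right_mono[OF bd[of s], of "\<bar>\<kappa> (t - s)\<bar>"] by (simp add: abs_mult mult.commute)
  qed (auto intro!: integrable_kernel_affine integrable_kernel_conv[OF _ bd] integrable_abs)
  also have "\<dots> = C * (LINT u|lborel. \<bar>\<kappa> u\<bar>)"
    using lborel_integral_real_affine[of "-1" "\<lambda>s. \<bar>\<kappa> s\<bar>" t] by simp
  finally show ?thesis .
qed

lemma energy_integrable:
  assumes [measurable]: "\<psi> \<in> borel_measurable borel" and bd: "\<And>s. \<bar>\<psi> s\<bar> \<le> C"
    and \<phi>: "integrable lborel \<phi>"
  shows "integrable lborel (\<lambda>t. \<phi> t * (LINT s|lborel. \<kappa> (t - s) * \<psi> s))"
proof (rule Bochner_Integration.integrable_bound)
  let ?L = "LINT u|lborel. \<bar>\<kappa> u\<bar>"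
  show "integrable lborel (\<lambda>t. (C * ?L) * \<phi> t)" using \<phi> by simp
  have [measurable]: "\<phi> \<in> borel_measurable borel"
    using borel_measurable_integrable[OF \<phi>] by simp
  show "(\<lambda>t. \<phi> t * (LINT s|lborel. \<kappa> (t - s) * \<psi> s)) \<in> borel_measurable lborel" by simp
  show "AE t in lborel. norm (\<phi> t * (LINT s|lborel. \<kappa> (t - s) * \<psi> s)) \<le> norm ((C * ?L) * \<phi> t)"
  proof (rule AE_I2)
    fix t
    have "norm (\<phi> t * (LINT s|lborel. \<kappa> (t - s) * \<psi> s)) \<le> \<bar>\<phi> t\<bar> * (C * ?L)"
      unfolding real_norm_def abs_mult by (intro mult_left_mono convolution_bound bd) auto
    also have "\<dots> \<le> norm ((C * ?L) * \<phi> t)"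
    proof -
      have "\<bar>\<phi> t\<bar> * (C * ?L) \<le> \<bar>\<phi> t\<bar> * \<bar>C * ?L\<bar>" by (rule mult_left_mono) auto
      then show ?thesis by (simp add: abs_mult mult_ac)
    qed
    finally show "norm (\<phi> t * (LINT s|lborel. \<kappa> (t - s) * \<psi> s)) \<le> norm ((C * ?L) * \<phi> t)" .
  qed
qed

text \<open>Positive type concerns continuous test functions only; this limit carries it to step
  functions. Dominated convergence is applied first to the convolution, then to the outer integral,
  where the common support supplies the majorant.\<close>

lemma energy_LIMSEQ:
  assumes m: "\<And>m. \<psi>\<^sub>n m \<in> borel_measurable borel"
    and bd: "\<And>m s. \<bar>\<psi>\<^sub>n m s\<bar> \<le> C * indicator {0..T} s"
    and lim: "\<And>s. (\<lambda>m. \<psi>\<^sub>n m s) \<longlonglongrightarrow> \<psi> s"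
  shows "(\<lambda>m. energy (\<psi>\<^sub>n m) (\<psi>\<^sub>n m)) \<longlonglongrightarrow> energy \<psi> \<psi>"
proof -
  note [measurable] = m
  have [measurable]: "\<psi> \<in> borel_measurable borel"
    by (rule borel_measurable_LIMSEQ_real[OF lim m])
  have C: "\<bar>\<psi>\<^sub>n m s\<bar> \<le> \<bar>C\<bar>" for m s
    using bd[of m s] by (cases "s \<in> {0..T}") auto
  have inner: "(\<lambda>m. LINT s|lborel. \<kappa> (t - s) * \<psi>\<^sub>n m s) \<longlonglongrightarrow> (LINT s|lborel. \<kappa> (t - s) * \<psi> s)" for t
  proof (rule integral_dominated_convergence)
    show "integrable lborel (\<lambda>s. \<bar>C\<bar> * \<bar>\<kappa> (t - s)\<bar>)"
      by (auto intro!: integrable_kernel_affine)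
    show "AE s in lborel. norm (\<kappa> (t - s) * \<psi>\<^sub>n m s) \<le> \<bar>C\<bar> * \<bar>\<kappa> (t - s)\<bar>" for m
      using C by (auto simp: abs_mult mult.commute intro!: mult_right_mono)
  qed (auto intro!: tendsto_intros lim)
  let ?L = "LINT u|lborel. \<bar>\<kappa> u\<bar>"
  show ?thesis
    unfolding energy_def
  proof (rule integral_dominated_convergence)
    show "integrable lborel (\<lambda>t. \<bar>C\<bar> * indicator {0..T} t * (\<bar>C\<bar> * ?L))"
      by (intro integrable_mult_left integrable_mult_right integrable_real_indicator emeasure_bounded_finite) auto
    show "AE t in lborel. norm (\<psi>\<^sub>n m t * (LINT s|lborel. \<kappa> (t - s) * \<psi>\<^sub>n m s))
        \<le> \<bar>C\<bar> * indicator {0..T} t * (\<bar>C\<bar> * ?L)" for m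
    proof (rule AE_I2)
      fix t
      have "\<bar>\<psi>\<^sub>n m t\<bar> \<le> \<bar>C\<bar> * indicator {0..T} t"
        using bd[of m t] by (cases "t \<in> {0..T}") auto
      then show "norm (\<psi>\<^sub>n m t * (LINT s|lborel. \<kappa> (t - s) * \<psi>\<^sub>n m s))
        \<le> \<bar>C\<bar> * indicator {0..T} t * (\<bar>C\<bar> * ?L)"
        unfolding real_norm_def abs_mult
        by (intro mult_mono convolution_bound C) auto
    qed
  qed (auto intro!: tendsto_intros lim inner)
qed

text \<open>By Fubini the boxes are integrated against each other first. The correlation of two
  boxes of width \<open>k\<close> with centres \<open>i * k\<close> and \<open>j * k\<close> is
  \<open>k\<close> times a hat in the shift \<open>u\<close>, which is the hat in
  \<open>weight\<close>.\<close>

lemma energy_boxes: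
  assumes k: "k > 0"
  defines "bx \<equiv> \<lambda>i::nat. indicator {real i * k - k / 2<..<real i * k + k / 2} :: real \<Rightarrow> real"
  shows "energy (bx i) (bx j) = k * weight k (int i - int j)"
proof -
  have [measurable]: "bx i \<in> borel_measurable borel" for i
    unfolding bx_def by simp
  have bx01: "0 \<le> bx i t" "bx i t \<le> 1" for i t
    unfolding bx_def by (auto simp: indicator_def)
  have bx_int: "integrable lborel (bx i)" for i
    unfolding bx_def by (intro integrable_real_indicator emeasure_bounded_finite) auto
  define F where "F t u = bx i t * (\<kappa> u * bx j (t - u))" for t u
  have [measurable]: "case_prod F \<in> borel_measurable (lborel \<Otimes>\<^sub>M lborel)"
    unfolding F_def by measurable
  have F_int: "integrable (lborel \<Otimes>\<^sub>M lborel) (case_prod F)"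
  proof (rule lborel_pair.Fubini_integrable)
    have Fn: "norm (F t u) = bx i t * (\<bar>\<kappa> u\<bar> * bx j (t - u))" for t u
      unfolding F_def by (simp add: abs_mult bx01)
    have int: "integrable lborel (\<lambda>u. \<bar>\<kappa> u\<bar> * bx j (t - u))" for t
    proof -
      have "integrable lborel (\<lambda>u. \<bar>\<kappa> u * bx j (t - u)\<bar>)"
        by (intro integrable_abs integrable_kernel_times[where C=1]) (use bx01 in auto)
      then show ?thesis by (simp add: abs_mult bx01)
    qed
    show "integrable lborel (\<lambda>t. LINT u|lborel. norm (case (t, u) of (t, u) \<Rightarrow> F t u))"
    proof (rule Bochner_Integration.integrable_bound)
      show "integrable lborel (\<lambda>t. (LINT u|lborel. \<bar>\<kappa> u\<bar>) * bx i t)"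
        using bx_int by simp
      show "AE t in lborel. norm (LINT u|lborel. norm (case (t, u) of (t, u) \<Rightarrow> F t u))
          \<le> norm ((LINT u|lborel. \<bar>\<kappa> u\<bar>) * bx i t)"
      proof (rule AE_I2)
        fix t
        have "(LINT u|lborel. \<bar>\<kappa> u\<bar> * bx j (t - u)) \<le> (LINT u|lborel. \<bar>\<kappa> u\<bar>)"
          by (rule integral_mono[OF int]) (use integrable_kernel bx01 in \<open>auto intro: mult_left_le\<close>)
        moreover have "0 \<le> (LINT u|lborel. \<bar>\<kappa> u\<bar> * bx j (t - u))"
          by (rule Bochner_Integration.integral_nonneg) (simp add: bx01)
        ultimately show "norm (LINT u|lborel. norm (case (t, u) of (t, u) \<Rightarrow> F t u))
          \<le> norm ((LINT u|lborel. \<bar>\<kappa> u\<bar>) * bx i t)"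
          unfolding prod.case Fn
          by (simp add: abs_mult bx01 mult.commute[of "bx i t"] mult_right_mono)
      qed
    qed (simp add: Fn, measurable)
    show "AE t in lborel. integrable lborel (\<lambda>u. case (t, u) of (t, u) \<Rightarrow> F t u)"
      unfolding F_def prod.case
      by (intro AE_I2 integrable_mult_right integrable_kernel_times[where C=1]) (use bx01 in auto)
  qed measurable
  \<comment> \<open>Length of the intersection of two intervals of half-width \<open>h\<close>
    centred at \<open>p\<close> and \<open>q + u\<close>.\<close>
  have overlap: "max 0 (min (p + h) (q + h + u) - max (p - h) (q - h + u)) = max (2 * h - \<bar>p - q - u\<bar>) 0"
    for p q h u :: real
    by (cases "p \<le> q + u") (auto simp: max_def min_def)
  have box_conv: "(LINT t|lborel. bx i t * bx j (t - u)) = k * hat (of_int (int i - int j) - u / k)" for u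
  proof -
    define a b where "a = max (real i * k - k / 2) (real j * k - k / 2 + u)"
      and "b = min (real i * k + k / 2) (real j * k + k / 2 + u)"
    have "(LINT t|lborel. bx i t * bx j (t - u)) = (LINT t|lborel. indicator {a<..<b} t)"
      by (intro Bochner_Integration.integral_cong) (auto simp: bx_def a_def b_def indicator_def)
    also have "\<dots> = max 0 (b - a)"
      by (cases "a \<le> b") (auto simp: measure_lborel_Ioo)
    also have "\<dots> = max (k - \<bar>real i * k - real j * k - u\<bar>) 0"
      using overlap[of "real i * k" "k / 2" "real j * k" u] by (simp add: a_def b_def)
    also have "\<dots> = k * max (1 - \<bar>real i * k - real j * k - u\<bar> / k) 0"
      using k by (simp add: max_mult_distrib_left algebra_simps)
    also have "\<bar>real i * k - real j * k - u\<bar> / k = \<bar>(real i * k - real j * k - u) / k\<bar>"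
      using k by simp
    also have "(real i * k - real j * k - u) / k = of_int (int i - int j) - u / k"
      using k by (simp add: field_simps)
    finally show ?thesis by (simp add: hat_def)
  qed
  have "energy (bx i) (bx j) = (LINT t|lborel. LINT u|lborel. F t u)"
    unfolding energy_def
  proof (rule Bochner_Integration.integral_cong[OF refl])
    fix t
    have "(LINT s|lborel. \<kappa> (t - s) * bx j s) = (LINT u|lborel. \<kappa> u * bx j (t - u))"
      using lborel_integral_real_affine[of "-1" "\<lambda>s. \<kappa> (t - s) * bx j s" t] by simp
    then show "bx i t * (LINT s|lborel. \<kappa> (t - s) * bx j s) = (LINT u|lborel. F t u)"
      unfolding F_def by simp
  qed
  also have "\<dots> = (LINT u|lborel. LINT t|lborel. F t u)"
    by (rule lborel_pair.Fubini_integral[OF F_int, symmetric])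
  also have "\<dots> = (LINT u|lborel. \<kappa> u * (LINT t|lborel. bx i t * bx j (t - u)))"
  proof (rule Bochner_Integration.integral_cong[OF refl])
    fix u
    have "F t u = \<kappa> u * (bx i t * bx j (t - u))" for t by (simp add: F_def)
    then show "(LINT t|lborel. F t u) = \<kappa> u * (LINT t|lborel. bx i t * bx j (t - u))" by simp
  qed
  also have "\<dots> = (LINT u|lborel. k * (\<kappa> u * hat (of_int (int i - int j) - u / k)))"
    by (simp add: box_conv mult.left_commute)
  also have "\<dots> = k * weight k (int i - int j)"
    by (simp add: weight_def)
  finally show ?thesis .
qed

lemma energy_sum:
  fixes g :: "nat \<Rightarrow> real \<Rightarrow> real"
  assumes [measurable]: "\<And>i. i \<in> I \<Longrightarrow> g i \<in> borel_measurable borel"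
    and bd: "\<And>i s. i \<in> I \<Longrightarrow> \<bar>g i s\<bar> \<le> 1" and int: "\<And>i. i \<in> I \<Longrightarrow> integrable lborel (g i)"
    and I: "finite I"
  shows "energy (\<lambda>t. \<Sum>i\<in>I. a i * g i t) (\<lambda>t. \<Sum>i\<in>I. a i * g i t)
    = (\<Sum>i\<in>I. \<Sum>j\<in>I. a i * a j * energy (g i) (g j))"
proof -
  have inner: "(LINT s|lborel. \<kappa> (t - s) * (\<Sum>j\<in>I. a j * g j s))
      = (\<Sum>j\<in>I. a j * (LINT s|lborel. \<kappa> (t - s) * g j s))" for t
  proof -
    have "(LINT s|lborel. \<kappa> (t - s) * (\<Sum>j\<in>I. a j * g j s))
      = (LINT s|lborel. (\<Sum>j\<in>I. a j * (\<kappa> (t - s) * g j s)))"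
      by (simp add: sum_distrib_left mult.left_commute)
    also have "\<dots> = (\<Sum>j\<in>I. LINT s|lborel. a j * (\<kappa> (t - s) * g j s))"
      by (intro Bochner_Integration.integral_sum integrable_mult_right integrable_kernel_conv[where C=1])
         (use bd in auto)
    finally show ?thesis by simp
  qed
  have int2: "integrable lborel (\<lambda>t. g i t * (LINT s|lborel. \<kappa> (t - s) * g j s))" if "i \<in> I" "j \<in> I" for i j
    using that by (intro energy_integrable[where C=1]) (use bd int in auto)
  have "energy (\<lambda>t. \<Sum>i\<in>I. a i * g i t) (\<lambda>t. \<Sum>i\<in>I. a i * g i t)
     = (LINT t|lborel. (\<Sum>i\<in>I. \<Sum>j\<in>I. a i * a j * (g i t * (LINT s|lborel. \<kappa> (t - s) * g j s))))"
    unfolding energy_def inner by (simp add: sum_product mult_ac)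
  also have "\<dots> = (\<Sum>i\<in>I. LINT t|lborel. (\<Sum>j\<in>I. a i * a j * (g i t * (LINT s|lborel. \<kappa> (t - s) * g j s))))"
    by (intro Bochner_Integration.integral_sum Bochner_Integration.integrable_sum integrable_mult_right int2)
  also have "\<dots> = (\<Sum>i\<in>I. \<Sum>j\<in>I. LINT t|lborel. a i * a j * (g i t * (LINT s|lborel. \<kappa> (t - s) * g j s)))"
    by (intro sum.cong refl Bochner_Integration.integral_sum integrable_mult_right int2)
  finally show ?thesis by (simp add: energy_def)
qed

end

context kernel_representative
begin

lemma energy_nonneg_continuous:
  assumes pt: "positive_type \<beta>" and T: "T > 0" and cont: "continuous_on UNIV \<phi>"
  defines "\<psi> \<equiv> \<lambda>t. \<phi> t * indicator {0..T} t"
  shows "0 \<le> energy \<psi> \<psi>"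
proof -
  have [measurable]: "\<phi> \<in> borel_measurable borel"
    using cont by (rule borel_measurable_continuous_onI)
  have [measurable]: "\<psi> \<in> borel_measurable borel"
    unfolding \<psi>_def by measurable
  have "0 \<le> (LINT t:{0..T}|lebesgue. \<phi> t * (LINT s:{0..t}|lebesgue. \<beta> (t - s) * \<phi> s))"
    using pt T continuous_on_subset[OF cont] unfolding positive_type_def by blast
  also have "\<dots> = (LINT t|lebesgue. \<psi> t * (LINT s|lborel. \<kappa> (t - s) * \<psi> s))"
    unfolding set_lebesgue_integral_def[of lebesgue "{0..T}"]
  proof (rule Bochner_Integration.integral_cong[OF refl])
    fix t
    show "indicator {0..T} t *\<^sub>R (\<phi> t * (LINT s:{0..t}|lebesgue. \<beta> (t - s) * \<phi> s))
       = \<psi> t * (LINT s|lborel. \<kappa> (t - s) * \<psi> s)"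
    proof (cases "t \<in> {0..T}")
      case True
      have "(LINT s:{0..t}|lebesgue. \<beta> (t - s) * \<phi> s) = (LINT s|lborel. \<kappa> (t - s) * (\<phi> s * indicator {0..t} s))"
        by (rule set_integral_convolution) auto
      \<comment> \<open>For \<open>s > t\<close> the kernel vanishes by causality, so the cut-offs
        at \<open>t\<close> and at \<open>T\<close> give the same integral.\<close>
      also have "\<dots> = (LINT s|lborel. \<kappa> (t - s) * \<psi> s)"
        using True by (intro Bochner_Integration.integral_cong) (auto simp: \<psi>_def indicator_def causal)
      finally show ?thesis using True by (simp add: \<psi>_def)
    qed (simp add: \<psi>_def)
  qed
  also have "\<dots> = energy \<psi> \<psi>"
    unfolding energy_def by (rule integral_completion) measurable
  finally show ?thesis .
qed

text \<open>Up to the factor \<open>k\<close> the form is the energy of the step function with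
  height \<open>a i\<close> on the i-th box, a pointwise limit of continuous functions. Excluding
  the index 0 keeps every box inside the half-line on which positive type is stated.\<close>

lemma weight_form_nonneg:
  assumes pt: "positive_type \<beta>" and k: "k > 0" and I: "finite I" "0 \<notin> I"
  shows "0 \<le> (\<Sum>i\<in>I. \<Sum>j\<in>I. weight k (int i - int j) * (a i * a j))"
proof -
  define bx where "bx = (\<lambda>i::nat. indicator {real i * k - k / 2<..<real i * k + k / 2} :: real \<Rightarrow> real)"
  \<comment> \<open>Trapezoids with edges of slope \<open>m\<close> that vanish off the open box:
    they converge to its indicator at every point, endpoints included.\<close>
  define trap where "trap m i t = min 1 (real m * max 0 (k / 2 - \<bar>t - real i * k\<bar>))" for m i t
  \<comment> \<open>\<open>Suc\<close> makes \<open>T\<close> positive and leaves room for the last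
    half box; \<open>insert 0\<close> covers the empty \<open>I\<close>.\<close>
  define T where "T = real (Suc (Max (insert 0 I))) * k"
  have T: "T > 0" using k by (simp add: T_def)
  have le_T: "real i * k + k / 2 \<le> T" if "i \<in> I" for i
  proof -
    have "real i \<le> real (Max (insert 0 I))" using I that by auto
    then have "real i * k \<le> real (Max (insert 0 I)) * k" using k by (intro mult_right_mono) auto
    moreover have "T = real (Max (insert 0 I)) * k + k" by (simp add: T_def algebra_simps)
    ultimately show ?thesis using k by linarith
  qed
  have ge_0: "0 \<le> real i * k - k / 2" if "i \<in> I" for i
  proof -
    have "1 \<le> real i" using I that by (cases i) auto
    then have "1 * k \<le> real i * k" using k by (intro mult_right_mono) auto
    then show ?thesis using k by simp
  qed
  have trap01: "0 \<le> trap m i t" "trap m i t \<le> 1" for m i t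
    by (auto simp: trap_def)
  have trap_lim: "(\<lambda>m. trap m i t) \<longlonglongrightarrow> bx i t" for i t
  proof (cases "\<bar>t - real i * k\<bar> < k / 2")
    case True
    obtain M :: nat where M: "1 / (k / 2 - \<bar>t - real i * k\<bar>) < real M"
      using reals_Archimedean2 by blast
    have "trap m i t = bx i t" if "m \<ge> M" for m
    proof -
      have "1 / (k / 2 - \<bar>t - real i * k\<bar>) < real m" using M that by linarith
      then have "1 < real m * (k / 2 - \<bar>t - real i * k\<bar>)"
        using True by (simp add: pos_divide_less_eq)
      moreover have "real i * k - k / 2 < t" "t < real i * k + k / 2" using True by linarith+
      then have "bx i t = 1" by (simp add: bx_def)
      ultimately show ?thesis using True by (simp add: trap_def)
    qed
    then show ?thesis
      by (intro tendsto_eventually) (auto simp: eventually_sequentially)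
  next
    case False
    then have "trap m i t = 0" "bx i t = 0" for m
      by (auto simp: trap_def bx_def indicator_def abs_if split: if_splits)
    then show ?thesis by simp
  qed
  define \<phi> where "\<phi> m t = (\<Sum>i\<in>I. a i * trap m i t)" for m t
  have cont: "continuous_on UNIV (\<phi> m)" for m
    unfolding \<phi>_def trap_def by (intro continuous_intros)
  have supp: "bx i t * indicator {0..T} t = bx i t" if "i \<in> I" for i t
    using le_T[OF that] ge_0[OF that] by (auto simp: bx_def indicator_def)
  have "(\<lambda>m. energy (\<lambda>t. \<phi> m t * indicator {0..T} t) (\<lambda>t. \<phi> m t * indicator {0..T} t))
     \<longlonglongrightarrow> energy (\<lambda>t. \<Sum>i\<in>I. a i * bx i t) (\<lambda>t. \<Sum>i\<in>I. a i * bx i t)"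
  proof (rule energy_LIMSEQ)
    show "(\<lambda>t. \<phi> m t * indicator {0..T} t) \<in> borel_measurable borel" for m
      using borel_measurable_continuous_onI[OF cont] by measurable
    show "\<bar>\<phi> m s * indicator {0..T} s\<bar> \<le> (\<Sum>i\<in>I. \<bar>a i\<bar>) * indicator {0..T} s" for m s
    proof -
      have "\<bar>\<phi> m s\<bar> \<le> (\<Sum>i\<in>I. \<bar>a i * trap m i s\<bar>)"
        unfolding \<phi>_def by (rule sum_abs)
      also have "\<dots> \<le> (\<Sum>i\<in>I. \<bar>a i\<bar>)"
        by (intro sum_mono) (simp add: abs_mult trap01 mult_left_le)
      finally show ?thesis by (simp add: indicator_def)
    qed
    show "(\<lambda>m. \<phi> m s * indicator {0..T} s) \<longlonglongrightarrow> (\<Sum>i\<in>I. a i * bx i s)" for s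
    proof -
      have "(\<lambda>m. \<phi> m s * indicator {0..T} s) \<longlonglongrightarrow> (\<Sum>i\<in>I. a i * bx i s) * indicator {0..T} s"
        unfolding \<phi>_def by (intro tendsto_intros trap_lim)
      also have "(\<Sum>i\<in>I. a i * bx i s) * indicator {0..T} s = (\<Sum>i\<in>I. a i * bx i s)"
        unfolding sum_distrib_right mult.assoc by (intro sum.cong refl) (simp add: supp)
      finally show ?thesis .
    qed
  qed
  then have "0 \<le> energy (\<lambda>t. \<Sum>i\<in>I. a i * bx i t) (\<lambda>t. \<Sum>i\<in>I. a i * bx i t)"
    using energy_nonneg_continuous[OF pt T cont] by (intro LIMSEQ_le_const) auto
  also have "\<dots> = (\<Sum>i\<in>I. \<Sum>j\<in>I. a i * a j * energy (bx i) (bx j))"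
    by (rule energy_sum) (auto simp: bx_def I intro!: integrable_real_indicator emeasure_bounded_finite)
  also have "\<dots> = (\<Sum>i\<in>I. \<Sum>j\<in>I. a i * a j * (k * weight k (int i - int j)))"
    unfolding bx_def using energy_boxes[OF k] by simp
  also have "\<dots> = k * (\<Sum>i\<in>I. \<Sum>j\<in>I. weight k (int i - int j) * (a i * a j))"
    by (simp add: sum_distrib_left mult_ac)
  finally show ?thesis using k by (simp add: zero_le_mult_iff)
qed

end

section \<open>Pairing of positive semidefinite matrices\<close>

lemma affine_nonneg_imp_slope_zero:
  fixes b d :: real
  assumes "\<And>x. 0 \<le> 2 * x * b + d"
  shows "b = 0"
proof (rule ccontr)
  assume "b \<noteq> 0"
  then show False
    \<comment> \<open>At this point the affine expression takes the value -1.\<close>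
    using assms[of "- (d + 1) / (2 * b)"] by (simp add: field_simps)
qed

text \<open>One elimination step splits off a rank-one matrix from \<open>K\<close>, whose pairing with \<open>G\<close> is a value
  of the quadratic form of \<open>G\<close>.\<close>

lemma Schur_pairing_nonneg:
  fixes K G :: "'i \<Rightarrow> 'i \<Rightarrow> real"
  assumes "finite I"
    and "\<And>i j. K i j = K j i"
    and "\<And>a. 0 \<le> (\<Sum>i\<in>I. \<Sum>j\<in>I. K i j * (a i * a j))"
    and G: "\<And>a J. J \<subseteq> I \<Longrightarrow> 0 \<le> (\<Sum>i\<in>J. \<Sum>j\<in>J. G i j * (a i * a j))"
  shows "0 \<le> (\<Sum>i\<in>I. \<Sum>j\<in>I. K i j * G i j)"
  using assms
proof (induction I arbitrary: K rule: finite_induct)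
  case empty
  then show ?case by simp
next
  case (insert p I)
  note sym = insert.prems(1) and psd = insert.prems(2) and G = insert.prems(3)
  have split: "(\<Sum>i\<in>insert p I. \<Sum>j\<in>insert p I. M i j)
      = M p p + (\<Sum>j\<in>I. M p j) + (\<Sum>i\<in>I. M i p) + (\<Sum>i\<in>I. \<Sum>j\<in>I. M i j)" for M :: "'i \<Rightarrow> 'i \<Rightarrow> real"
    using insert.hyps by (simp add: sum.distrib)
  have form: "(\<Sum>i\<in>insert p I. \<Sum>j\<in>insert p I. K i j * ((a(p := x)) i * (a(p := x)) j))
      = K p p * x\<^sup>2 + 2 * x * (\<Sum>j\<in>I. K p j * a j) + (\<Sum>i\<in>I. \<Sum>j\<in>I. K i j * (a i * a j))" for a x
  proof -
    have e: "(a(p := x)) i = a i" if "i \<in> I" for i using that insert.hyps by auto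
    have "(\<Sum>j\<in>I. K p j * ((a(p := x)) p * (a(p := x)) j)) = x * (\<Sum>j\<in>I. K p j * a j)"
      unfolding sum_distrib_left by (intro sum.cong refl) (use insert.hyps in auto)
    moreover have "(\<Sum>i\<in>I. K i p * ((a(p := x)) i * (a(p := x)) p)) = x * (\<Sum>j\<in>I. K p j * a j)"
      unfolding sum_distrib_left
    proof (rule sum.cong[OF refl])
      fix i assume "i \<in> I"
      then show "K i p * ((a(p := x)) i * (a(p := x)) p) = x * (K p i * a i)"
        using insert.hyps sym[of i p] by auto
    qed
    moreover have "(\<Sum>i\<in>I. \<Sum>j\<in>I. K i j * ((a(p := x)) i * (a(p := x)) j)) = (\<Sum>i\<in>I. \<Sum>j\<in>I. K i j * (a i * a j))"
      using insert.hyps by (intro sum.cong refl) auto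
    ultimately show ?thesis
      unfolding split by (simp add: power2_eq_square)
  qed
  have pp: "0 \<le> K p p"
    using psd[of "(\<lambda>_. 0)(p := 1)"] form[of "\<lambda>_. 0" 1] by simp
  have G_sub: "0 \<le> (\<Sum>i\<in>J. \<Sum>j\<in>J. G i j * (a i * a j))" if "J \<subseteq> I" for J a
    using that by (intro G) auto
  \<comment> \<open>Schur complement of the pivot \<open>K p p\<close>. With a zero pivot nothing is
    eliminated, because then the whole row turns out to be zero on \<open>I\<close>.\<close>
  define K' where "K' i j = (if K p p = 0 then K i j else K i j - K p i * K p j / K p p)" for i j
  have "0 \<le> (\<Sum>i\<in>I. \<Sum>j\<in>I. K' i j * G i j)"
  proof (rule insert.IH)
    show "K' i j = K' j i" for i j
      by (simp add: K'_def sym[of i j] mult.commute)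
    show "0 \<le> (\<Sum>i\<in>I. \<Sum>j\<in>I. K' i j * (a i * a j))" for a
    proof (cases "K p p = 0")
      case True
      then show ?thesis
        using psd[of "a(p := 0)"] form[of a 0] by (simp add: K'_def)
    next
      case False
      define s where "s = (\<Sum>j\<in>I. K p j * a j)"
      have ss: "(\<Sum>i\<in>I. \<Sum>j\<in>I. (K p i * a i) * (K p j * a j)) = s\<^sup>2"
        by (simp add: s_def power2_eq_square sum_product)
      have "(\<Sum>i\<in>I. \<Sum>j\<in>I. K' i j * (a i * a j))
          = (\<Sum>i\<in>I. \<Sum>j\<in>I. K i j * (a i * a j) - (K p i * a i) * (K p j * a j) / K p p)"
        using False by (simp add: K'_def algebra_simps)
      also have "\<dots> = (\<Sum>i\<in>I. \<Sum>j\<in>I. K i j * (a i * a j)) - s\<^sup>2 / K p p"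
        by (simp add: sum_subtractf ss flip: sum_divide_distrib)
      \<comment> \<open>The value \<open>x = - s / K p p\<close> minimises the quadratic in
        \<open>form\<close>; at this minimum the form of \<open>K\<close> equals that of
        \<open>K'\<close>.\<close>
      also have "\<dots> = (\<Sum>i\<in>insert p I. \<Sum>j\<in>insert p I. K i j * ((a(p := - s / K p p)) i * (a(p := - s / K p p)) j))"
        unfolding form s_def[symmetric] using False by (simp add: power2_eq_square field_simps)
      finally show ?thesis using psd by simp
    qed
  qed (use G_sub in auto)
  moreover have "(\<Sum>i\<in>I. \<Sum>j\<in>I. K' i j * G i j) \<le> (\<Sum>i\<in>insert p I. \<Sum>j\<in>insert p I. K i j * G i j)"
  proof (cases "K p p = 0")
    case True
    \<comment> \<open>On the vectors with entry 1 at \<open>i\<close> and \<open>x\<close> at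
      \<open>p\<close>, the zero pivot leaves a nonnegative affine function of \<open>x\<close> with
      slope \<open>2 * K p i\<close>.\<close>
    have row: "K p i = 0" if "i \<in> I" for i
    proof (rule affine_nonneg_imp_slope_zero)
      fix x
      have "(\<Sum>j\<in>I. K p j * (if j = i then 1 else 0)) = K p i"
        using that insert.hyps by (simp add: if_distrib[of "(*) _"] cong: if_cong)
      then show "0 \<le> 2 * x * K p i + (\<Sum>l\<in>I. \<Sum>j\<in>I. K l j * ((if l = i then 1 else 0) * (if j = i then 1 else 0)))"
        using psd[of "(\<lambda>j. if j = i then 1 else 0)(p := x)"] True
        unfolding form by simp
    qed
    have "(\<Sum>j\<in>I. K p j * G p j) = 0" "(\<Sum>j\<in>I. K j p * G j p) = 0"
      using row sym by (auto intro!: sum.neutral)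
    then show ?thesis unfolding split using True by (simp add: K'_def)
  next
    case False
    have K'_p: "K' p j = 0" "K' j p = 0" for j
      using False by (simp_all add: K'_def sym[of j p])
    \<comment> \<open>\<open>K - K'\<close> is the rank-one matrix built from row \<open>p\<close>,
      so its pairing with \<open>G\<close> is the form of \<open>G\<close> at that row, divided by
      the pivot.\<close>
    have "0 \<le> (\<Sum>i\<in>insert p I. \<Sum>j\<in>insert p I. G i j * (K p i * K p j)) / K p p"
      using pp by (intro divide_nonneg_nonneg G) auto
    also have "\<dots> = (\<Sum>i\<in>insert p I. \<Sum>j\<in>insert p I. K i j * G i j - K' i j * G i j)"
      unfolding sum_divide_distrib using False
      by (intro sum.cong refl) (simp add: K'_def algebra_simps)
    also have "\<dots> = (\<Sum>i\<in>insert p I. \<Sum>j\<in>insert p I. K i j * G i j)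
         - (\<Sum>i\<in>insert p I. \<Sum>j\<in>insert p I. K' i j * G i j)"
      by (simp only: sum_subtractf)
    also have "(\<Sum>i\<in>insert p I. \<Sum>j\<in>insert p I. K' i j * G i j) = (\<Sum>i\<in>I. \<Sum>j\<in>I. K' i j * G i j)"
      unfolding split by (simp add: K'_p)
    finally show ?thesis by simp
  qed
  ultimately show ?case by linarith
qed

section \<open>Positivity of the memory term for vector sequences\<close>

lemma linear_operator_on_sum:
  assumes "linear_operator_on D B" "finite I" "\<And>i. i \<in> I \<Longrightarrow> x i \<in> D"
  shows "(\<Sum>i\<in>I. a i *\<^sub>R x i) \<in> D \<and> B (\<Sum>i\<in>I. a i *\<^sub>R x i) = (\<Sum>i\<in>I. a i *\<^sub>R B (x i))"
  using assms(2,3)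
proof (induction I rule: finite_induct)
  case empty
  have "0 \<in> D" using assms(1) by (simp add: linear_operator_on_def subspace_0)
  then have "B (0 *\<^sub>R 0) = 0 *\<^sub>R B 0"
    using assms(1) unfolding linear_operator_on_def by blast
  then show ?case using \<open>0 \<in> D\<close> by simp
next
  case (insert p I)
  have "a p *\<^sub>R x p \<in> D" "B (a p *\<^sub>R x p) = a p *\<^sub>R B (x p)"
    using assms(1) insert.prems by (auto simp: linear_operator_on_def subspace_scale)
  then show ?case
    using assms(1) insert by (auto simp: linear_operator_on_def subspace_add)
qed

text \<open>The double sum is the quadratic form of \<open>B\<close> at the combination of the
  \<open>x i\<close> with coefficients \<open>a i\<close>, which stays in the subspace
  \<open>D\<close>.\<close>

lemma positive_self_adjoint_gram:
  assumes B: "positive_self_adjoint D B" and x: "\<And>i. i \<in> I \<Longrightarrow> x i \<in> D" and I: "finite I"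
  shows "0 \<le> (\<Sum>i\<in>I. \<Sum>j\<in>I. inner (x i) (B (x j)) * (a i * a j))"
proof -
  have lin: "linear_operator_on D B" and pos: "\<And>x. x \<in> D \<Longrightarrow> 0 \<le> inner (B x) x"
    using B by (auto simp: positive_self_adjoint_def self_adjoint_def)
  note s = linear_operator_on_sum[OF lin I x]
  have "0 \<le> inner (B (\<Sum>i\<in>I. a i *\<^sub>R x i)) (\<Sum>i\<in>I. a i *\<^sub>R x i)"
    using s by (intro pos) auto
  also have "\<dots> = (\<Sum>j\<in>I. \<Sum>i\<in>I. inner (x i) (B (x j)) * (a i * a j))"
    using s by (simp add: inner_sum_left inner_sum_right inner_commute mult_ac)
  also have "\<dots> = (\<Sum>i\<in>I. \<Sum>j\<in>I. inner (x i) (B (x j)) * (a i * a j))"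
    by (rule sum.swap)
  finally show ?thesis .
qed

lemma positive_self_adjoint_sym:
  assumes "positive_self_adjoint D B" "x \<in> D" "y \<in> D"
  shows "inner x (B y) = inner y (B x)"
proof -
  have "(y, B y) \<in> adjoint_graph D B"
    using assms by (auto simp: positive_self_adjoint_def self_adjoint_def)
  then show ?thesis using assms by (auto simp: adjoint_graph_def inner_commute)
qed

text \<open>The Schur argument needs a symmetric matrix, while the Toeplitz matrix is triangular. So
  its symmetrisation is paired with \<open>G\<close>; symmetry of \<open>G\<close> makes both halves
  contribute equally, which yields twice the wanted sum.\<close>

lemma discrete_energy_nonneg:
  assumes B: "positive_self_adjoint D B" and pt: "positive_type \<beta>"
    and L1: "set_integrable lebesgue {0<..} \<beta>" and k: "k > 0"
    and x: "\<And>n. n \<ge> 1 \<Longrightarrow> x n \<in> D"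
  shows "0 \<le> (\<Sum>n=1..N. inner (x n) (\<Sum>l=1..n. quad_w k \<beta> (n - l) *\<^sub>R B (x l)))"
proof -
  obtain \<kappa> M where "kernel_representative \<kappa> \<beta> M"
    using kernel_representative_exists[OF L1] by blast
  then interpret kernel_representative \<kappa> \<beta> M .
  define v where "v i j = weight k (int i - int j)" for i j
  \<comment> \<open>Zero outside the indices with \<open>x n \<in> D\<close>, so that symmetry holds
    for all pairs.\<close>
  define G where "G i j = (if i \<ge> 1 \<and> j \<ge> 1 then inner (x i) (B (x j)) else 0)" for i j
  have G_sym: "G i j = G j i" for i j
    using positive_self_adjoint_sym[OF B x x] by (simp add: G_def)
  have swap: "(\<Sum>i=1..N. \<Sum>j=1..N. v j i * g i j) = (\<Sum>i=1..N. \<Sum>j=1..N. v i j * g i j)"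
    if "\<And>i j. g i j = g j i" for g :: "nat \<Rightarrow> nat \<Rightarrow> real"
    by (subst sum.swap) (simp add: that)
  have "0 \<le> (\<Sum>i=1..N. \<Sum>j=1..N. (v i j + v j i) * G i j)"
  proof (rule Schur_pairing_nonneg)
    fix a :: "nat \<Rightarrow> real"
    have "0 \<le> 2 * (\<Sum>i=1..N. \<Sum>j=1..N. v i j * (a i * a j))"
      using weight_form_nonneg[OF pt k, of "{1..N}" a] by (simp add: v_def)
    also have "\<dots> = (\<Sum>i=1..N. \<Sum>j=1..N. v i j * (a i * a j)) + (\<Sum>i=1..N. \<Sum>j=1..N. v j i * (a i * a j))"
      by (subst swap) (auto simp: mult.commute)
    finally show "0 \<le> (\<Sum>i=1..N. \<Sum>j=1..N. (v i j + v j i) * (a i * a j))"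
      by (simp add: sum.distrib distrib_right)
  next
    fix J a
    assume J: "J \<subseteq> {1..N}"
    have "0 \<le> (\<Sum>i\<in>J. \<Sum>j\<in>J. inner (x i) (B (x j)) * (a i * a j))"
      using J by (intro positive_self_adjoint_gram[OF B x]) (auto intro: finite_subset)
    also have "\<dots> = (\<Sum>i\<in>J. \<Sum>j\<in>J. G i j * (a i * a j))"
      using J by (intro sum.cong refl) (auto simp: G_def)
    finally show "0 \<le> (\<Sum>i\<in>J. \<Sum>j\<in>J. G i j * (a i * a j))" .
  qed auto
  also have "\<dots> = 2 * (\<Sum>i=1..N. \<Sum>j=1..N. v i j * G i j)"
    unfolding distrib_right sum.distrib by (subst swap[OF G_sym]) simp
  also have "(\<Sum>i=1..N. \<Sum>j=1..N. v i j * G i j)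
      = (\<Sum>n=1..N. inner (x n) (\<Sum>l=1..n. quad_w k \<beta> (n - l) *\<^sub>R B (x l)))"
  proof (rule sum.cong[OF refl])
    fix i assume i: "i \<in> {1..N}"
    \<comment> \<open>Entries above the diagonal vanish by \<open>weight_negative\<close>.\<close>
    have "(\<Sum>j=1..N. v i j * G i j) = (\<Sum>j=1..i. v i j * G i j)"
      using i by (intro sum.mono_neutral_right) (auto simp: v_def weight_negative[OF k])
    also have "\<dots> = (\<Sum>j=1..i. inner (x i) (quad_w k \<beta> (i - j) *\<^sub>R B (x j)))"
      using i by (intro sum.cong refl) (auto simp: v_def G_def quad_w_eq[OF k] of_nat_diff)
    finally show "(\<Sum>j=1..N. v i j * G i j) = inner (x i) (\<Sum>l=1..i. quad_w k \<beta> (i - l) *\<^sub>R B (x l))"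
      by (simp add: inner_sum_right)
  qed
  finally show ?thesis by simp
qed

text \<open>Abel summation as an induction: \<open>d N\<close> times the N-th partial sum stays
  below the weighted sum, since lowering the weight of a nonnegative partial sum only decreases
  it.\<close>

lemma weighted_sum_nonneg:
  fixes p d :: "nat \<Rightarrow> real"
  assumes S: "\<And>N. 0 \<le> (\<Sum>n=1..N. p n)" and d: "decseq d" "\<And>n. 0 \<le> d n"
  shows "0 \<le> (\<Sum>n=1..N. d n * p n)"
proof -
  have "d N * (\<Sum>n=1..N. p n) \<le> (\<Sum>n=1..N. d n * p n)"
  proof (induction N)
    case (Suc N)
    have "d (Suc N) * (\<Sum>n=1..N. p n) \<le> d N * (\<Sum>n=1..N. p n)"
      using d S by (intro mult_right_mono) (auto simp: decseq_SucD)
    then show ?case using Suc by (simp add: distrib_left)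
  qed simp
  moreover have "0 \<le> d N * (\<Sum>n=1..N. p n)" using S d by simp
  ultimately show ?thesis by linarith
qed

subsection \<open>The weighted energy estimate\<close>

text \<open>\<open>V = W + SW\<close> with \<open>S\<close> the right shift, which has norm \<open>r\<close> in the weighted \<open>\<ell>\<^sup>2\<close> space; then
  \<open>\<parallel>V\<parallel> \<le> (1 + r) \<parallel>W\<parallel>\<close>, and telescoping gives \<open>\<langle>W - SW, V\<rangle> \<ge> (1 - r\<^sup>2) \<parallel>W\<parallel>\<^sup>2\<close>.\<close>

lemma weighted_shift_coercive:
  fixes V W :: "nat \<Rightarrow> 'a::real_inner"
  assumes r: "0 < r" "r < 1" and W0: "W 0 = 0"
    and V: "\<And>n. n \<ge> 1 \<Longrightarrow> V n = W n + W (n - 1)"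
  shows "(1 - r) * (\<Sum>n=1..N. r ^ (2 * n) * (norm (V n))\<^sup>2)
     \<le> (1 + r) * (\<Sum>n=1..N. r ^ (2 * n) * inner (W n - W (n - 1)) (V n))"
proof -
  define Y where "Y = (\<Sum>n=1..N. r ^ (2 * n) * (norm (W n))\<^sup>2)"
  \<comment> \<open>Shifting the index costs a factor \<open>r\<^sup>2\<close>; the boundary term at
    \<open>M\<close> is nonnegative and is dropped afterwards.\<close>
  have tele: "(\<Sum>n=1..M. r ^ (2 * n) * ((norm (W n))\<^sup>2 - (norm (W (n - 1)))\<^sup>2))
     = (1 - r\<^sup>2) * (\<Sum>n=1..M. r ^ (2 * n) * (norm (W n))\<^sup>2) + r ^ (2 * M + 2) * (norm (W M))\<^sup>2" for M
    by (induction M) (simp_all add: W0 power2_eq_square algebra_simps)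
  have inner: "inner (W n - W (n - 1)) (V n) = (norm (W n))\<^sup>2 - (norm (W (n - 1)))\<^sup>2" if "n \<ge> 1" for n
    using V[OF that] by (simp add: power2_norm_eq_inner inner_diff_left inner_diff_right inner_add_left inner_add_right inner_commute)
  have "(1 - r\<^sup>2) * Y \<le> (\<Sum>n=1..N. r ^ (2 * n) * ((norm (W n))\<^sup>2 - (norm (W (n - 1)))\<^sup>2))"
    unfolding tele Y_def using r by simp
  also have "\<dots> = (\<Sum>n=1..N. r ^ (2 * n) * inner (W n - W (n - 1)) (V n))"
    by (intro sum.cong refl arg_cong2[where f="(*)"] inner[symmetric]) auto
  finally have lower: "(1 - r\<^sup>2) * Y \<le> (\<Sum>n=1..N. r ^ (2 * n) * inner (W n - W (n - 1)) (V n))" .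
  have shift: "(\<Sum>n=1..N. r ^ (2 * n) * (norm (W (n - 1)))\<^sup>2) \<le> r\<^sup>2 * Y"
  proof -
    have "(\<Sum>n=1..M. r ^ (2 * n) * (norm (W (n - 1)))\<^sup>2) + r ^ (2 * M + 2) * (norm (W M))\<^sup>2
       = r\<^sup>2 * (\<Sum>n=1..M. r ^ (2 * n) * (norm (W n))\<^sup>2)" for M
      by (induction M) (simp_all add: W0 power2_eq_square algebra_simps)
    from this[of N] show ?thesis unfolding Y_def using r
      by (smt (verit) mult_nonneg_nonneg zero_le_power zero_le_power2)
  qed
  \<comment> \<open>The weights are exact when \<open>norm (W (n - 1)) = r * norm (W n)\<close>;
    with \<open>shift\<close> they add up to \<open>(1 + r)\<^sup>2\<close>.\<close>
  have young: "(norm (V n))\<^sup>2 \<le> (1 + r) * (norm (W n))\<^sup>2 + (1 + r) / r * (norm (W (n - 1)))\<^sup>2" if "n \<ge> 1" for n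
  proof -
    have "(norm (V n))\<^sup>2 \<le> (norm (W n) + norm (W (n - 1)))\<^sup>2"
      unfolding V[OF that] by (intro power_mono norm_triangle_ineq) auto
    also have "\<dots> = (1 + r) * (norm (W n))\<^sup>2 + (1 + r) / r * (norm (W (n - 1)))\<^sup>2
        - (r * norm (W n) - norm (W (n - 1)))\<^sup>2 / r"
      using r by (simp add: power2_eq_square field_simps)
    also have "\<dots> \<le> (1 + r) * (norm (W n))\<^sup>2 + (1 + r) / r * (norm (W (n - 1)))\<^sup>2"
      using r by simp
    finally show ?thesis .
  qed
  have "(\<Sum>n=1..N. r ^ (2 * n) * (norm (V n))\<^sup>2)
     \<le> (\<Sum>n=1..N. r ^ (2 * n) * ((1 + r) * (norm (W n))\<^sup>2 + (1 + r) / r * (norm (W (n - 1)))\<^sup>2))"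
    using r by (intro sum_mono mult_left_mono young) auto
  also have "\<dots> = (1 + r) * Y + (1 + r) / r * (\<Sum>n=1..N. r ^ (2 * n) * (norm (W (n - 1)))\<^sup>2)"
    by (simp add: Y_def sum_distrib_left sum.distrib distrib_left mult_ac)
  also have "\<dots> \<le> (1 + r) * Y + (1 + r) / r * (r\<^sup>2 * Y)"
    using shift r by (intro add_left_mono mult_left_mono) auto
  also have "\<dots> = (1 + r)\<^sup>2 * Y"
    using r by (simp add: power2_eq_square field_simps)
  finally have "(1 - r) * (\<Sum>n=1..N. r ^ (2 * n) * (norm (V n))\<^sup>2) \<le> (1 - r) * ((1 + r)\<^sup>2 * Y)"
    using r by (intro mult_left_mono) auto
  also have "\<dots> = (1 + r) * ((1 - r\<^sup>2) * Y)"
    by (simp add: power2_eq_square algebra_simps)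
  also have "\<dots> \<le> (1 + r) * (\<Sum>n=1..N. r ^ (2 * n) * inner (W n - W (n - 1)) (V n))"
    using lower r by (intro mult_left_mono) auto
  finally show ?thesis .
qed

text \<open>The data are controlled in the weighted l1 norm, so \<open>V\<close> enters through its
  weighted supremum, which is at most its weighted l2 norm.\<close>

lemma weighted_Cauchy_Schwarz:
  fixes V g :: "nat \<Rightarrow> 'a::real_inner"
  assumes r: "0 < r"
  shows "(\<Sum>n=1..N. r ^ (2 * n) * inner (g n) (V n))
     \<le> (\<Sum>n=1..N. r ^ n * norm (g n)) * sqrt (\<Sum>n=1..N. r ^ (2 * n) * (norm (V n))\<^sup>2)"
proof -
  let ?y = "sqrt (\<Sum>n=1..N. r ^ (2 * n) * (norm (V n))\<^sup>2)"
  have V: "r ^ n * norm (V n) \<le> ?y" if "n \<in> {1..N}" for n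
  proof -
    have "(r ^ n * norm (V n))\<^sup>2 \<le> (\<Sum>n=1..N. r ^ (2 * n) * (norm (V n))\<^sup>2)"
      using that r member_le_sum[of n "{1..N}" "\<lambda>n. r ^ (2 * n) * (norm (V n))\<^sup>2"]
      by (simp add: power_mult_distrib power_mult[symmetric] mult.commute)
    then show ?thesis by (rule real_le_rsqrt)
  qed
  have "(\<Sum>n=1..N. r ^ (2 * n) * inner (g n) (V n)) \<le> (\<Sum>n=1..N. r ^ n * norm (g n) * ?y)"
  proof (rule sum_mono)
    fix n assume n: "n \<in> {1..N}"
    have "r ^ (2 * n) * inner (g n) (V n) \<le> r ^ (2 * n) * (norm (g n) * norm (V n))"
      using r by (intro mult_left_mono norm_cauchy_schwarz) auto
    also have "\<dots> = r ^ n * norm (g n) * (r ^ n * norm (V n))"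
      unfolding mult_2 power_add by (simp only: mult_ac)
    also have "\<dots> \<le> r ^ n * norm (g n) * ?y"
      using r by (intro mult_left_mono V[OF n]) auto
    finally show "r ^ (2 * n) * inner (g n) (V n) \<le> r ^ n * norm (g n) * ?y" .
  qed
  then show ?thesis by (simp add: sum_distrib_right)
qed

lemma sum_power_from_1_le:
  fixes r :: real
  assumes "0 < r" "r < 1"
  shows "(\<Sum>n=1..N. r ^ n) \<le> r / (1 - r)"
proof -
  have "(1 - r) * (\<Sum>n=1..N. r ^ n) = r - r ^ Suc N"
  proof (induction N)
    case (Suc N)
    have "(1 - r) * (\<Sum>n=1..Suc N. r ^ n) = (1 - r) * (\<Sum>n=1..N. r ^ n) + (1 - r) * r ^ Suc N"
      by (simp add: distrib_left)
    also have "\<dots> = (r - r ^ Suc N) + (1 - r) * r ^ Suc N"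
      by (simp only: Suc)
    also have "\<dots> = r - r ^ Suc (Suc N)"
      by (simp add: algebra_simps)
    finally show ?case .
  qed simp
  then have "(\<Sum>n=1..N. r ^ n) = (r - r ^ Suc N) / (1 - r)"
    using assms by (simp add: eq_divide_eq mult.commute)
  also have "\<dots> \<le> r / (1 - r)"
    using assms by (intro divide_right_mono) auto
  finally show ?thesis .
qed

text \<open>The three terms on the right come from \<open>f\<close>, from the alternating starting
  defect \<open>E\<close> and from the \<open>quad_chi\<close> column at level 0. The only
  dependence on \<open>N\<close> there is the partial sum of \<open>f\<close>, so summability can be
  deduced later.\<close>

lemma crank_nicolson_weighted_bound:
  fixes U :: "nat \<Rightarrow> 'a::real_inner"
  assumes B: "\<And>q. q \<in> Q \<Longrightarrow> positive_self_adjoint (D q) (B q)"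
    and pt: "\<And>q. q \<in> Q \<Longrightarrow> positive_type (\<beta> q)"
    and L1: "\<And>q. q \<in> Q \<Longrightarrow> set_integrable lebesgue {0<..} (\<beta> q)"
    and k: "k > 0" and r: "0 < r" "r < 1"
    and UD: "\<And>q n. q \<in> Q \<Longrightarrow> U n \<in> D q"
    and scheme: "\<And>n. n \<ge> 1 \<Longrightarrow>
           backward_diff k U n + (\<Sum>q\<in>Q. half_level (quad k (\<beta> q) (\<lambda>m. B q (U m))) n) = half_level f n"
  shows "sqrt (\<Sum>n=1..N. r ^ (2 * n) * (norm (U n))\<^sup>2)
     \<le> k * (1 + r) / (2 * (1 - r)) * ((\<Sum>n=1..N. r ^ n * norm (f n))
        + r / (1 - r) * norm (f 0 + (2 / k) *\<^sub>R U 0)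
        + r * (\<Sum>q\<in>Q. L1_norm (\<beta> q) * norm (B q (U 0))))"
proof -
  define Qn where "Qn n = (\<Sum>q\<in>Q. quad k (\<beta> q) (\<lambda>m. B q (U m)) n)" for n
  define E where "E = f 0 + (2 / k) *\<^sub>R U 0"
  \<comment> \<open>Explicit alternating-sum solution of the averaging recursion. It starts at
    \<open>l = 1\<close>, so \<open>U 0\<close> enters only through \<open>E\<close> and
    \<open>quad_chi\<close>.\<close>
  define W where "W n = (\<Sum>l=1..n. (-1) ^ (n - l) *\<^sub>R U l)" for n
  have W0: "W 0 = 0" by (simp add: W_def)
  have W_Suc: "W (Suc n) + W n = U (Suc n)" for n
  proof -
    have "(\<Sum>l=1..n. (-1) ^ (Suc n - l) *\<^sub>R U l) = - W n"
      unfolding W_def sum_negf[symmetric] by (intro sum.cong refl) (simp add: Suc_diff_le)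
    then show ?thesis by (simp add: W_def)
  qed
  have Q0: "Qn 0 = 0" by (simp add: Qn_def quad_def quad_chi_def)
  have step: "(2 / k) *\<^sub>R (U (Suc n) - U n) = (f (Suc n) - Qn (Suc n)) + (f n - Qn n)" for n
  proof -
    have "(\<Sum>q\<in>Q. half_level (quad k (\<beta> q) (\<lambda>m. B q (U m))) (Suc n)) = (1 / 2) *\<^sub>R (Qn (Suc n) + Qn n)"
      by (simp add: half_level_def midpoint_def Qn_def flip: sum.distrib scaleR_sum_right)
    then have "(U (Suc n) - U n) /\<^sub>R k + (1 / 2) *\<^sub>R (Qn (Suc n) + Qn n) = (1 / 2) *\<^sub>R (f (Suc n) + f n)"
      using scheme[of "Suc n"] by (simp add: backward_diff_def half_level_def midpoint_def)
    then have "(U (Suc n) - U n) /\<^sub>R k = (1 / 2) *\<^sub>R (f (Suc n) + f n) - (1 / 2) *\<^sub>R (Qn (Suc n) + Qn n)"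
      by (simp only: eq_diff_eq)
    then have "2 *\<^sub>R ((U (Suc n) - U n) /\<^sub>R k) = (f (Suc n) + f n) - (Qn (Suc n) + Qn n)"
      by (simp only: scaleR_diff_right scaleR_scaleR) simp
    then show ?thesis
      by (simp add: divide_inverse)
  qed
  \<comment> \<open>\<open>step\<close> has a sum of two consecutive levels on the right;
    subtracting the previous identity leaves one level and flips the sign of the remainder. At
    \<open>n = 0\<close> this remainder is \<open>E\<close>, because
    \<open>Qn 0 = 0\<close>.\<close>
  have W_diff: "(2 / k) *\<^sub>R (W (Suc n) - W n) = f (Suc n) - Qn (Suc n) + (-1) ^ n *\<^sub>R E" for n
  proof (induction n)
    case 0
    have "W (Suc 0) = U (Suc 0)" using W_Suc[of 0] by (simp add: W0)
    then show ?case using step[of 0] by (simp add: W0 Q0 E_def algebra_simps)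
  next
    case (Suc n)
    have "W (Suc (Suc n)) - W (Suc n) = (U (Suc (Suc n)) - U (Suc n)) - (W (Suc n) - W n)"
      using W_Suc[of n] W_Suc[of "Suc n"] by (simp add: algebra_simps flip: W_Suc)
    then have "(2 / k) *\<^sub>R (W (Suc (Suc n)) - W (Suc n))
        = (2 / k) *\<^sub>R (U (Suc (Suc n)) - U (Suc n)) - (2 / k) *\<^sub>R (W (Suc n) - W n)"
      by (simp only: scaleR_diff_right)
    also have "\<dots> = f (Suc (Suc n)) - Qn (Suc (Suc n)) + (-1) ^ Suc n *\<^sub>R E"
      unfolding step Suc.IH by simp
    finally show ?case .
  qed
  define P where "P q n = (\<Sum>l=1..n. quad_w k (\<beta> q) (n - l) *\<^sub>R B q (U l))" for q n
  define g where "g n = f n + (-1) ^ (n - 1) *\<^sub>R E - (\<Sum>q\<in>Q. quad_chi k (\<beta> q) n *\<^sub>R B q (U 0))" for n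
  have g: "(2 / k) *\<^sub>R (W n - W (n - 1)) = g n - (\<Sum>q\<in>Q. P q n)" if "n \<ge> 1" for n
  proof -
    have "Qn n = (\<Sum>q\<in>Q. quad_chi k (\<beta> q) n *\<^sub>R B q (U 0)) + (\<Sum>q\<in>Q. P q n)"
      by (simp add: Qn_def quad_def P_def sum.distrib)
    then show ?thesis using W_diff[of "n - 1"] that by (simp add: g_def)
  qed
  have memory: "0 \<le> (\<Sum>n=1..N. r ^ (2 * n) * inner (P q n) (U n))" if "q \<in> Q" for q
  proof (rule weighted_sum_nonneg)
    show "0 \<le> (\<Sum>n=1..M. inner (P q n) (U n))" for M
      using discrete_energy_nonneg[OF B[OF that] pt[OF that] L1[OF that] k, of U M] UD[OF that]
      by (simp add: P_def inner_commute)
    show "decseq (\<lambda>n. r ^ (2 * n))"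
      using r by (intro decseq_SucI power_decreasing) auto
    show "0 \<le> r ^ (2 * n)" for n using r by simp
  qed
  define X where "X = (\<Sum>n=1..N. r ^ (2 * n) * (norm (U n))\<^sup>2)"
  have X: "0 \<le> X" unfolding X_def using r by (intro sum_nonneg) auto
  have "(2 / k) * (\<Sum>n=1..N. r ^ (2 * n) * inner (W n - W (n - 1)) (U n))
     = (\<Sum>n=1..N. r ^ (2 * n) * inner ((2 / k) *\<^sub>R (W n - W (n - 1))) (U n))"
    by (simp add: sum_distrib_left mult_ac)
  also have "\<dots> = (\<Sum>n=1..N. r ^ (2 * n) * inner (g n - (\<Sum>q\<in>Q. P q n)) (U n))"
    by (intro sum.cong refl arg_cong2[where f="(*)"] arg_cong2[where f=inner] g) auto
  also have "\<dots> = (\<Sum>n=1..N. r ^ (2 * n) * inner (g n) (U n)) - (\<Sum>n=1..N. \<Sum>q\<in>Q. r ^ (2 * n) * inner (P q n) (U n))"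
    by (simp add: inner_diff_left inner_sum_left right_diff_distrib sum_subtractf sum_distrib_left)
  also have "(\<Sum>n=1..N. \<Sum>q\<in>Q. r ^ (2 * n) * inner (P q n) (U n)) = (\<Sum>q\<in>Q. \<Sum>n=1..N. r ^ (2 * n) * inner (P q n) (U n))"
    by (rule sum.swap)
  \<comment> \<open>The memory terms are subtracted and nonnegative, hence dropped.\<close>
  also have "(\<Sum>n=1..N. r ^ (2 * n) * inner (g n) (U n)) - \<dots> \<le> (\<Sum>n=1..N. r ^ (2 * n) * inner (g n) (U n))"
    using sum_nonneg[of Q, OF memory] by simp
  also have "\<dots> \<le> (\<Sum>n=1..N. r ^ n * norm (g n)) * sqrt X"
    unfolding X_def by (rule weighted_Cauchy_Schwarz) (rule r)
  finally have upper: "(2 / k) * (\<Sum>n=1..N. r ^ (2 * n) * inner (W n - W (n - 1)) (U n))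
     \<le> (\<Sum>n=1..N. r ^ n * norm (g n)) * sqrt X" .
  have "(1 - r) * X \<le> (1 + r) * (\<Sum>n=1..N. r ^ (2 * n) * inner (W n - W (n - 1)) (U n))"
    unfolding X_def
  proof (rule weighted_shift_coercive[where W=W and V=U, OF r W0])
    show "U n = W n + W (n - 1)" if "n \<ge> 1" for n
      using that W_Suc[of "n - 1"] by simp
  qed
  also have "\<dots> = k * (1 + r) / 2 * ((2 / k) * (\<Sum>n=1..N. r ^ (2 * n) * inner (W n - W (n - 1)) (U n)))"
    using k by simp
  also have "\<dots> \<le> k * (1 + r) / 2 * ((\<Sum>n=1..N. r ^ n * norm (g n)) * sqrt X)"
    using k r by (intro mult_left_mono upper) auto
  finally have main: "(1 - r) * (sqrt X * sqrt X) \<le> k * (1 + r) / 2 * ((\<Sum>n=1..N. r ^ n * norm (g n)) * sqrt X)"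
    using X by simp
  have "sqrt X \<le> k * (1 + r) / (2 * (1 - r)) * (\<Sum>n=1..N. r ^ n * norm (g n))"
  proof (cases "sqrt X = 0")
    case True
    have "0 \<le> k * (1 + r) / (2 * (1 - r)) * (\<Sum>n=1..N. r ^ n * norm (g n))"
      using k r by (intro mult_nonneg_nonneg divide_nonneg_nonneg sum_nonneg) auto
    then show ?thesis using True by simp
  next
    case False
    then have "0 < sqrt X" using X by simp
    moreover have "((1 - r) * sqrt X) * sqrt X \<le> (k * (1 + r) / 2 * (\<Sum>n=1..N. r ^ n * norm (g n))) * sqrt X"
      using main by (simp only: mult_ac)
    ultimately have "(1 - r) * sqrt X \<le> k * (1 + r) / 2 * (\<Sum>n=1..N. r ^ n * norm (g n))"
      by (rule mult_right_le_imp_le[rotated])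
    then show ?thesis using r by (simp add: field_simps)
  qed
  also have "\<dots> \<le> k * (1 + r) / (2 * (1 - r)) * ((\<Sum>n=1..N. r ^ n * norm (f n))
        + r / (1 - r) * norm E + r * (\<Sum>q\<in>Q. L1_norm (\<beta> q) * norm (B q (U 0))))"
  proof (rule mult_left_mono)
    have "r ^ n * norm (g n) \<le> r ^ n * norm (f n) + r ^ n * norm E
         + r * (\<Sum>q\<in>Q. \<bar>quad_chi k (\<beta> q) n\<bar> * norm (B q (U 0)))" if "n \<in> {1..N}" for n
    proof -
      have "norm (\<Sum>q\<in>Q. quad_chi k (\<beta> q) n *\<^sub>R B q (U 0)) \<le> (\<Sum>q\<in>Q. \<bar>quad_chi k (\<beta> q) n\<bar> * norm (B q (U 0)))"
        (is "_ \<le> ?c") by (rule sum_norm_le) simp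
      moreover have "norm ((-1) ^ (n - 1) *\<^sub>R E) = norm E" by (simp add: power_abs)
      ultimately have "norm (g n) \<le> norm (f n) + norm E + ?c"
        unfolding g_def by (smt (verit) norm_triangle_ineq norm_triangle_ineq4)
      then have "r ^ n * norm (g n) \<le> r ^ n * (norm (f n) + norm E + ?c)"
        using r by (intro mult_left_mono) auto
      \<comment> \<open>Here \<open>n \<ge> 1\<close> matters: it gives the factor \<open>r\<close>,
        after which the sum over \<open>n\<close> of \<open>quad_chi\<close> is bounded without
        weights.\<close>
      moreover have "r ^ n * ?c \<le> r * ?c"
      proof (intro mult_right_mono)
        show "r ^ n \<le> r" using that r power_decreasing[of 1 n r] by simp
      qed (auto intro!: sum_nonneg)
      ultimately show ?thesis by (simp add: distrib_left)
    qed
    then have "(\<Sum>n=1..N. r ^ n * norm (g n)) \<le> (\<Sum>n=1..N. r ^ n * norm (f n) + r ^ n * norm E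
         + r * (\<Sum>q\<in>Q. \<bar>quad_chi k (\<beta> q) n\<bar> * norm (B q (U 0))))"
      by (rule sum_mono)
    also have "\<dots> = (\<Sum>n=1..N. r ^ n * norm (f n)) + (\<Sum>n=1..N. r ^ n) * norm E
         + r * (\<Sum>n=1..N. \<Sum>q\<in>Q. \<bar>quad_chi k (\<beta> q) n\<bar> * norm (B q (U 0)))"
      by (simp only: sum.distrib sum_distrib_left sum_distrib_right)
    also have "(\<Sum>n=1..N. \<Sum>q\<in>Q. \<bar>quad_chi k (\<beta> q) n\<bar> * norm (B q (U 0)))
        = (\<Sum>q\<in>Q. (\<Sum>n=1..N. \<bar>quad_chi k (\<beta> q) n\<bar>) * norm (B q (U 0)))"
      unfolding sum_distrib_right by (rule sum.swap)
    also have "(\<Sum>n=1..N. r ^ n * norm (f n)) + (\<Sum>n=1..N. r ^ n) * norm E + r * \<dots>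
      \<le> (\<Sum>n=1..N. r ^ n * norm (f n)) + r / (1 - r) * norm E + r * (\<Sum>q\<in>Q. L1_norm (\<beta> q) * norm (B q (U 0)))"
    proof (intro add_mono order.refl mult_right_mono mult_left_mono sum_mono sum_power_from_1_le r)
      fix q assume "q \<in> Q"
      then obtain \<kappa> M where "kernel_representative \<kappa> (\<beta> q) M"
        using kernel_representative_exists[OF L1] by blast
      then interpret kernel_representative \<kappa> "\<beta> q" M .
      show "(\<Sum>n=1..N. \<bar>quad_chi k (\<beta> q) n\<bar>) \<le> L1_norm (\<beta> q)"
        by (rule sum_quad_chi_le[OF k])
    qed (use r in auto)
    finally show "(\<Sum>n=1..N. r ^ n * norm (g n)) \<le> (\<Sum>n=1..N. r ^ n * norm (f n))
        + r / (1 - r) * norm E + r * (\<Sum>q\<in>Q. L1_norm (\<beta> q) * norm (B q (U 0)))" .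
  qed (use k r in simp)
  finally show ?thesis
    unfolding X_def E_def .
qed

text \<open>Here \<open>a\<close> stands for \<open>exp (c/2)\<close>, and \<open>u\<close> for
  \<open>norm (U 0)\<close>, whose square is the level 0 part of the weighted norm. Squaring the
  finite estimate gives the claimed constant for \<open>F\<close> exactly; the slack in the constant
  of \<open>A\<close> absorbs \<open>u\<^sup>2\<close>.\<close>

lemma bound_constants_le:
  fixes a k F A u b1 b2 :: real
  assumes a: "a > 1" and k: "k > 0" and u: "0 \<le> u" "2 * u \<le> A"
  shows "u\<^sup>2 + (k * (a + 1) / (2 * (a - 1)) * (F + A / (k * (a - 1)) + (b1 + b2) / a))\<^sup>2
    \<le> a\<^sup>2 * (1 + a) ^ 4 / (a - 1) ^ 6 * A\<^sup>2
      + (1 + a) ^ 4 * k\<^sup>2 / (a\<^sup>2 * (a - 1)\<^sup>2) * (b1\<^sup>2 + b2\<^sup>2)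
      + (1 + a) ^ 4 * k\<^sup>2 / (2 * (a\<^sup>2 - 1)\<^sup>2) * F\<^sup>2"
proof -
  define C where "C = k * (a + 1) / (2 * (a - 1))"
  \<comment> \<open>Weighted Cauchy-Schwarz with 1/2 + 1/4 + 1/8 + 1/8 = 1; the factor 2 on
    \<open>x\<close> is dictated by the constant of \<open>F\<close>.\<close>
  have young: "(x + y + (s + t))\<^sup>2 \<le> 2 * x\<^sup>2 + 4 * y\<^sup>2 + 8 * (s\<^sup>2 + t\<^sup>2)" for x y s t :: real
  proof -
    have "2 * x\<^sup>2 + 4 * y\<^sup>2 + 8 * (s\<^sup>2 + t\<^sup>2) - (x + y + (s + t))\<^sup>2
      = (x - y - (s + t))\<^sup>2 + 2 * (y - (s + t))\<^sup>2 + 4 * (s - t)\<^sup>2"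
      by (simp add: power2_eq_square algebra_simps)
    moreover have "0 \<le> (x - y - (s + t))\<^sup>2 + 2 * (y - (s + t))\<^sup>2 + 4 * (s - t)\<^sup>2" by simp
    ultimately show ?thesis by linarith
  qed
  have "(C * (F + A / (k * (a - 1)) + (b1 + b2) / a))\<^sup>2
     = C\<^sup>2 * (F + A / (k * (a - 1)) + (b1 / a + b2 / a))\<^sup>2"
    by (simp add: power_mult_distrib add_divide_distrib)
  also have "\<dots> \<le> C\<^sup>2 * (2 * F\<^sup>2 + 4 * (A / (k * (a - 1)))\<^sup>2 + 8 * ((b1 / a)\<^sup>2 + (b2 / a)\<^sup>2))"
    by (intro mult_left_mono young) auto
  also have "\<dots> = 2 * C\<^sup>2 * F\<^sup>2 + (4 * C\<^sup>2 / (k * (a - 1))\<^sup>2) * A\<^sup>2 + (8 * C\<^sup>2 / a\<^sup>2) * (b1\<^sup>2 + b2\<^sup>2)"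
    by (simp add: power_divide algebra_simps add_divide_distrib)
  finally have K: "(C * (F + A / (k * (a - 1)) + (b1 + b2) / a))\<^sup>2
    \<le> 2 * C\<^sup>2 * F\<^sup>2 + (4 * C\<^sup>2 / (k * (a - 1))\<^sup>2) * A\<^sup>2 + (8 * C\<^sup>2 / a\<^sup>2) * (b1\<^sup>2 + b2\<^sup>2)" .
  have a2: "a\<^sup>2 - 1 = (a - 1) * (a + 1)"
    by (simp add: power2_eq_square algebra_simps)
  have C2: "C\<^sup>2 = k\<^sup>2 * (1 + a)\<^sup>2 / (4 * (a - 1)\<^sup>2)"
    unfolding C_def power_divide power_mult_distrib by (simp add: add.commute)
  have cF: "2 * C\<^sup>2 = (1 + a) ^ 4 * k\<^sup>2 / (2 * (a\<^sup>2 - 1)\<^sup>2)"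
  proof -
    have "(1 + a) ^ 4 = (a + 1)\<^sup>2 * (1 + a)\<^sup>2" by (simp add: add.commute flip: power_add)
    then show ?thesis using a unfolding a2 C2 power_mult_distrib by simp
  qed
  have cb: "8 * C\<^sup>2 / a\<^sup>2 \<le> (1 + a) ^ 4 * k\<^sup>2 / (a\<^sup>2 * (a - 1)\<^sup>2)"
  proof -
    have "2\<^sup>2 \<le> (1 + a)\<^sup>2" using a by (intro power_mono) auto
    then have "2 * (1 + a)\<^sup>2 \<le> (1 + a)\<^sup>2 * (1 + a)\<^sup>2" by (intro mult_right_mono) auto
    then have "2 * (1 + a)\<^sup>2 * k\<^sup>2 / (a\<^sup>2 * (a - 1)\<^sup>2) \<le> (1 + a) ^ 4 * k\<^sup>2 / (a\<^sup>2 * (a - 1)\<^sup>2)"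
      by (intro divide_right_mono mult_right_mono) (auto simp flip: power_add)
    then show ?thesis unfolding C2 by (simp add: mult_ac)
  qed
  \<comment> \<open>The summand 1/4 pays for \<open>u\<^sup>2\<close>, since \<open>u\<close> is at
    most \<open>A / 2\<close>.\<close>
  have cA: "4 * C\<^sup>2 / (k * (a - 1))\<^sup>2 + 1 / 4 \<le> a\<^sup>2 * (1 + a) ^ 4 / (a - 1) ^ 6"
  proof -
    define p where "p = (1 + a) / (a - 1)"
    have p: "p > 1" using a by (simp add: p_def)
    have "4 * C\<^sup>2 / (k * (a - 1))\<^sup>2 = p\<^sup>2 / (a - 1)\<^sup>2"
      using k by (simp add: C2 p_def power_divide power_mult_distrib)
    moreover have "a\<^sup>2 * (1 + a) ^ 4 / (a - 1) ^ 6 = a\<^sup>2 * (p ^ 4 / (a - 1)\<^sup>2)"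
      by (simp add: p_def power_divide flip: power_add)
    moreover have "p\<^sup>2 / (a - 1)\<^sup>2 + 1 \<le> a\<^sup>2 * (p ^ 4 / (a - 1)\<^sup>2)"
    proof -
      have "p\<^sup>2 \<le> p ^ 4" using p by (intro power_increasing) auto
      then have "p\<^sup>2 / (a - 1)\<^sup>2 \<le> p ^ 4 / (a - 1)\<^sup>2" by (intro divide_right_mono) auto
      \<comment> \<open>The factor \<open>a\<^sup>2\<close> exceeds 1, and the surplus
        \<open>a\<^sup>2 - 1\<close> contributes exactly \<open>p ^ 5\<close>.\<close>
      moreover have "1 \<le> (a\<^sup>2 - 1) * (p ^ 4 / (a - 1)\<^sup>2)"
      proof -
        have "(a\<^sup>2 - 1) * (p ^ 4 / (a - 1)\<^sup>2) = p * p ^ 4"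
          using a unfolding a2 p_def by (simp add: power2_eq_square add.commute)
        also have "\<dots> = p ^ 5" by (simp add: numeral_eq_Suc)
        finally show ?thesis using p by (simp add: one_le_power)
      qed
      ultimately show ?thesis by (simp only: left_diff_distrib)
    qed
    ultimately show ?thesis by linarith
  qed
  have "u\<^sup>2 \<le> (A / 2)\<^sup>2" using u by (intro power_mono) auto
  then have "u\<^sup>2 + (4 * C\<^sup>2 / (k * (a - 1))\<^sup>2) * A\<^sup>2 \<le> (4 * C\<^sup>2 / (k * (a - 1))\<^sup>2 + 1 / 4) * A\<^sup>2"
    by (simp add: power_divide algebra_simps)
  also have "\<dots> \<le> a\<^sup>2 * (1 + a) ^ 4 / (a - 1) ^ 6 * A\<^sup>2"
    by (intro mult_right_mono cA) auto
  finally have "u\<^sup>2 + (4 * C\<^sup>2 / (k * (a - 1))\<^sup>2) * A\<^sup>2 \<le> a\<^sup>2 * (1 + a) ^ 4 / (a - 1) ^ 6 * A\<^sup>2" .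
  moreover have "(8 * C\<^sup>2 / a\<^sup>2) * (b1\<^sup>2 + b2\<^sup>2) \<le> (1 + a) ^ 4 * k\<^sup>2 / (a\<^sup>2 * (a - 1)\<^sup>2) * (b1\<^sup>2 + b2\<^sup>2)"
    by (intro mult_right_mono cb) auto
  ultimately show ?thesis
    using K unfolding cF C_def[symmetric] by linarith
qed

section \<open>Passage to the infinite weighted sums\<close>

theorem theorem4p2:
  fixes D :: "nat \<Rightarrow> 'a::{real_inner, complete_space} set"
    and B :: "nat \<Rightarrow> 'a \<Rightarrow> 'a"
    and \<beta> :: "nat \<Rightarrow> real \<Rightarrow> real"
    and f :: "real \<Rightarrow> 'a"
    and u0 :: 'a
    and U :: "nat \<Rightarrow> 'a"
    and c k :: real
  assumes "\<And>q. q \<in> {1,2} \<Longrightarrow> positive_self_adjoint (D q) (B q)"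
    and "\<And>q. q \<in> {1,2} \<Longrightarrow> admissible_kernel (\<beta> q)"
    and "\<And>q. q \<in> {1,2} \<Longrightarrow> set_integrable lebesgue {0<..} (\<beta> q)"
    and "c > 0" and "k > 0"
    and "\<And>n. U n \<in> D 1 \<inter> D 2"
    and "\<And>n. n \<ge> 1 \<Longrightarrow>
           backward_diff k U n + (\<Sum>q\<in>{1,2}. half_level (quad k (\<beta> q) (\<lambda>m. B q (U m))) n)
             = half_level (grid k f) n"
    and "U 0 = u0"
  shows "(norm_A c U)\<^sup>2 \<le>
      ennreal (exp c * (1 + exp (c/2)) ^ 4 / (exp (c/2) - 1) ^ 6
                 * (k * norm (grid k f 0) + 2 * norm (U 0))\<^sup>2)
    + ennreal (\<Sum>q\<in>{1,2}. (L1_norm (\<beta> q))\<^sup>2 * (1 + exp (c/2)) ^ 4 * k\<^sup>2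
                 / (exp c * (exp (c/2) - 1)\<^sup>2) * (norm (B q (U 0)))\<^sup>2)
    + ennreal ((1 + exp (c/2)) ^ 4 * k\<^sup>2 / (2 * (exp c - 1)\<^sup>2))
        * (\<Sum>n. ennreal (exp (- (c/2) * real n) * norm (grid k f n)))\<^sup>2"
    (is "_ \<le> ennreal ?T1 + ennreal ?T2 + ennreal ?c3 * (\<Sum>n. ennreal (?f n))\<^sup>2")
proof (cases "summable ?f")
  \<comment> \<open>A divergent data sum makes the right-hand side infinite, because its coefficient
    is strictly positive.\<close>
  case False
  have "1 < exp c" using \<open>c > 0\<close> by simp
  then have "0 < ?c3" using \<open>k > 0\<close>
    by (intro divide_pos_pos mult_pos_pos zero_less_power) (auto intro: add_pos_pos)
  then have "ennreal ?c3 \<noteq> 0"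
    by (simp only: ennreal_eq_0_iff not_le)
  moreover have "(\<Sum>n. ennreal (?f n)) = \<infinity>"
  proof (rule ccontr)
    assume "(\<Sum>n. ennreal (?f n)) \<noteq> \<infinity>"
    then have "summable ?f"
      unfolding infinity_ennreal_def by (rule summable_suminf_not_top[rotated]) simp
    then show False using False by contradiction
  qed
  ultimately have "ennreal ?c3 * (\<Sum>n. ennreal (?f n))\<^sup>2 = \<infinity>"
    by (simp only: infinity_ennreal_def power_top_ennreal ennreal_mult_top) simp
  moreover have "x \<le> y + z + w" if "w = \<infinity>" for x y z w :: ennreal
    using that by simp
  ultimately show ?thesis by blast
next
  case True
  define r a where "r = exp (- (c / 2))" and "a = exp (c / 2)"
  define F where "F = (\<Sum>n. ?f n)"
  define A where "A = k * norm (grid k f 0) + 2 * norm (U 0)"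
  define b where "b q = L1_norm (\<beta> q) * norm (B q (U 0))" for q
  have r: "0 < r" "r < 1" using \<open>c > 0\<close> by (auto simp: r_def)
  have a: "a > 1" using \<open>c > 0\<close> by (simp add: a_def)
  have ra: "r = 1 / a" by (simp add: r_def a_def exp_minus inverse_eq_divide)
  have a2: "exp c = a\<^sup>2"
    by (simp add: a_def power2_eq_square flip: exp_add)
  have rn: "exp (- (c / 2) * real n) = r ^ n" for n
    by (simp add: r_def mult.commute flip: exp_of_nat_mult)
  have r2n: "exp (- c * real n) = r ^ (2 * n)" for n
    by (simp add: r_def mult.commute flip: exp_of_nat_mult)
  have F: "(\<Sum>n. ennreal (?f n)) = ennreal F" "0 \<le> F"
    unfolding F_def by (rule suminf_ennreal2[OF _ True], simp) (rule suminf_nonneg[OF True], simp)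
  \<comment> \<open>The finite estimate rewritten with \<open>r = 1 / a\<close> and the full data
    sum \<open>F\<close>, hence independent of \<open>N\<close>.\<close>
  define K where "K = k * (a + 1) / (2 * (a - 1)) * (F + A / (k * (a - 1)) + (b 1 + b 2) / a)"
  have "sqrt (\<Sum>n=1..N. r ^ (2 * n) * (norm (U n))\<^sup>2) \<le> K" for N
  proof -
    have coeff: "k * (1 + r) / (2 * (1 - r)) = k * (a + 1) / (2 * (a - 1))" "r / (1 - r) = 1 / (a - 1)"
      using a by (auto simp: ra field_simps)
    have "sqrt (\<Sum>n=1..N. r ^ (2 * n) * (norm (U n))\<^sup>2)
     \<le> k * (1 + r) / (2 * (1 - r)) * ((\<Sum>n=1..N. r ^ n * norm (grid k f n))
        + r / (1 - r) * norm (grid k f 0 + (2 / k) *\<^sub>R U 0)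
        + r * (\<Sum>q\<in>{1,2}. L1_norm (\<beta> q) * norm (B q (U 0))))"
    proof (rule crank_nicolson_weighted_bound)
      show "positive_self_adjoint (D q) (B q)" if "q \<in> {1,2}" for q using assms(1)[OF that] .
      show "positive_type (\<beta> q)" if "q \<in> {1,2}" for q
        using assms(2)[OF that] by (simp add: admissible_kernel_def)
      show "set_integrable lebesgue {0<..} (\<beta> q)" if "q \<in> {1,2}" for q using assms(3)[OF that] .
      show "U n \<in> D q" if "q \<in> {1,2}" for q n using assms(6)[of n] that by auto
      show "backward_diff k U n + (\<Sum>q\<in>{1,2}. half_level (quad k (\<beta> q) (\<lambda>m. B q (U m))) n)
             = half_level (grid k f) n" if "n \<ge> 1" for n using assms(7)[OF that] .
    qed (use r \<open>k > 0\<close> in auto)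
    also have "\<dots> \<le> K"
      unfolding K_def coeff
    proof (intro mult_left_mono add_mono)
      show "(\<Sum>n=1..N. r ^ n * norm (grid k f n)) \<le> F"
        unfolding F_def rn[symmetric] by (intro sum_le_suminf True) auto
      have "norm (grid k f 0 + (2 / k) *\<^sub>R U 0) \<le> norm (grid k f 0) + (2 / k) * norm (U 0)"
        using \<open>k > 0\<close> norm_triangle_ineq[of "grid k f 0" "(2 / k) *\<^sub>R U 0"] by simp
      also have "\<dots> = A / k" using \<open>k > 0\<close> by (simp add: A_def add_divide_distrib)
      finally have "1 / (a - 1) * norm (grid k f 0 + (2 / k) *\<^sub>R U 0) \<le> 1 / (a - 1) * (A / k)"
        using a by (intro mult_left_mono) auto
      then show "1 / (a - 1) * norm (grid k f 0 + (2 / k) *\<^sub>R U 0) \<le> A / (k * (a - 1))"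
        by (simp add: mult.commute)
      show "r * (\<Sum>q\<in>{1,2}. L1_norm (\<beta> q) * norm (B q (U 0))) \<le> (b 1 + b 2) / a"
        by (simp add: b_def ra)
      show "0 \<le> k * (a + 1) / (2 * (a - 1))" using a \<open>k > 0\<close> by simp
    qed
    finally show ?thesis .
  qed
  then have tail: "(\<Sum>n=1..N. r ^ (2 * n) * (norm (U n))\<^sup>2) \<le> K\<^sup>2" for N
    by (rule sqrt_le_D)
  have partial: "(\<Sum>n<N. exp (- c * real n) * (norm (U n))\<^sup>2) \<le> (norm (U 0))\<^sup>2 + K\<^sup>2" for N
  proof -
    have "(\<Sum>n<N. exp (- c * real n) * (norm (U n))\<^sup>2) \<le> (\<Sum>n\<in>{0..N}. r ^ (2 * n) * (norm (U n))\<^sup>2)"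
      unfolding r2n using r by (intro sum_mono2) auto
    also have "\<dots> = (norm (U 0))\<^sup>2 + (\<Sum>n=1..N. r ^ (2 * n) * (norm (U n))\<^sup>2)"
      by (simp add: sum.atLeast_Suc_atMost)
    finally show ?thesis using tail[of N] by linarith
  qed
  \<comment> \<open>Summability has to be proved, as \<open>norm_A\<close> is infinite otherwise; it
    follows from the uniform bound on partial sums.\<close>
  have sm: "summable (\<lambda>n. exp (- c * real n) * (norm (U n))\<^sup>2)"
    by (rule summableI_nonneg_bounded[OF _ partial]) simp
  have "(\<Sum>n. exp (- c * real n) * (norm (U n))\<^sup>2) \<le> (norm (U 0))\<^sup>2 + K\<^sup>2"
    by (rule suminf_le_const[OF sm partial])
  also have "\<dots> \<le> a\<^sup>2 * (1 + a) ^ 4 / (a - 1) ^ 6 * A\<^sup>2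
      + (1 + a) ^ 4 * k\<^sup>2 / (a\<^sup>2 * (a - 1)\<^sup>2) * ((b 1)\<^sup>2 + (b 2)\<^sup>2)
      + (1 + a) ^ 4 * k\<^sup>2 / (2 * (a\<^sup>2 - 1)\<^sup>2) * F\<^sup>2"
    unfolding K_def using a \<open>k > 0\<close> by (intro bound_constants_le) (auto simp: A_def)
  also have "\<dots> = ?T1 + ?T2 + ?c3 * F\<^sup>2"
  proof -
    have "L\<^sup>2 * x * y / z * n\<^sup>2 = x * y / z * (L * n)\<^sup>2" for L n x y z :: real
      by (simp add: power_mult_distrib)
    then have "?T2 = (1 + a) ^ 4 * k\<^sup>2 / (a\<^sup>2 * (a - 1)\<^sup>2) * ((b 1)\<^sup>2 + (b 2)\<^sup>2)"
      unfolding a2 a_def[symmetric] b_def by (simp only: distrib_left) simp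
    then show ?thesis
      unfolding a2 a_def[symmetric] A_def by (simp only:)
  qed
  finally have real_bound: "(\<Sum>n. exp (- c * real n) * (norm (U n))\<^sup>2) \<le> ?T1 + ?T2 + ?c3 * F\<^sup>2" .
  have "0 \<le> (\<Sum>n. exp (- c * real n) * (norm (U n))\<^sup>2)"
    by (rule suminf_nonneg[OF sm]) simp
  then have "(norm_A c U)\<^sup>2 = ennreal (\<Sum>n. exp (- c * real n) * (norm (U n))\<^sup>2)"
    using sm by (simp add: norm_A_def ennreal_power)
  also have "\<dots> \<le> ennreal (?T1 + ?T2 + ?c3 * F\<^sup>2)"
    using real_bound by (rule ennreal_leI)
  also have "\<dots> = ennreal ?T1 + ennreal ?T2 + ennreal ?c3 * (ennreal F)\<^sup>2"
  proof -
    have "0 \<le> ?T1" "0 \<le> ?T2" "0 \<le> ?c3"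
      by (auto intro!: mult_nonneg_nonneg divide_nonneg_nonneg sum_nonneg add_nonneg_nonneg)
    moreover have "ennreal (x + y + z * F\<^sup>2) = ennreal x + ennreal y + ennreal z * (ennreal F)\<^sup>2"
      if "0 \<le> x" "0 \<le> y" "0 \<le> z" for x y z :: real
      using that F(2) by (simp add: ennreal_plus ennreal_mult ennreal_power)
    ultimately show ?thesis by blast
  qed
  finally show ?thesis unfolding F(1) .
qed

end
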